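(* Suppose that there exist measurable functions $L_n:\Theta_n\to(0,\infty)$, $n\in\mathbb{N}$, and $M_n:\prod_{k=1}^n\Theta_k\to[0,\infty)$, $n\ge n_0$, with some $n_0\in\mathbb{N}$, as well as a point $x_0\in X$, such that the following conditions hold: (A1) For each $n\in\mathbb{N}$ and $\vartheta_n$-a.e. $\theta\in\Theta_n$, $\rho\big(S_\theta^{(n)}(x),S_\theta^{(n)}(y)\big)\le L_n(\theta)\rho(x,y)$ for any $x,y\in X$. (A2) For every $E\in\mathcal{B}((0,\infty))$, $\vartheta_n(L_n^{-1}(E))$ does not depend on $n$, and $R:=\int_{\Theta_1}L_1(\theta)\,\vartheta_1(d\theta)<\infty$, $\int_{\Theta_1}\ln L_1(\theta)\,\vartheta_1(d\theta)<0$. (A3) For every $n\ge n_0$ and $\bigotimes_{k=1}^n\vartheta_k$-a.e. $(\theta_1,\ldots,\theta_n)\in\prod_{k=1}^n\Theta_k$, the transformations $S_{\theta_1}^{(1)},\ldots,S_{\theta_n}^{(n)}$ are invertible, and $$\rho\Big(x_0,\big(\mathcal{S}_{\theta_1,\ldots,\theta_{n-1}}^{-1}\circ S_{\theta_n}^{(n)}\circ\mathcal{S}_{\theta_1,\ldots,\theta_{n-1}}\big)(x_0)\Big)\le M_n(\theta_1,\ldots,\theta_n).$$ (A4) $\displaystyle \delta:=\sup_{n\ge n_0}\int_{\Theta_1}\ldots\int_{\Theta_n}M_n(\theta_1,\ldots,\theta_n)\,\vartheta_n(d\theta_n)\ldots\vartheta_1(d\theta_1)<\infty.$ Then there exist a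 measure $\pi\in\mathcal{M}_1(X)$ and constants $q\in(0,1)$, $C\in[0,\infty)$ such that $$d_{BL}\big(\mu P^{(n)},\pi\big)\le Cq^n\big(1+\langle V,\mu\rangle\big)\quad\text{for any }\mu\in\mathcal{M}_{1,1}(X),\ n\in\mathbb{N},$$ with $V(x):=\rho(x,x_0)$ for $x\in X$, and, in particular, $\mu P^{(n)}$ converges weakly to $\pi$ as $n\to\infty$ for every $\mu\in\mathcal{M}_1(X)$.
   Context: Setting. $(X,\rho)$ is a Polish (complete separable) metric space with Borel $\sigma$-field $\mathcal{B}(X)$; $\{(\Theta_n,\mathcal{A}_n,\vartheta_n)\}_{n\in\mathbb{N}}$ is an arbitrary sequence of probability spaces; for each $n\in\mathbb{N}$, $\{S_\theta^{(n)}:\theta\in\Theta_n\}$ is a family of maps from $X$ into itself such that $X\times\Theta_n\ni(x,\theta)\mapsto S_\theta^{(n)}(x)\in X$ is $\mathcal{B}(X)\otimes\mathcal{A}_n/\mathcal{B}(X)$-measurable. For $\theta_k\in\Theta_k$, $\mathcal{S}_{\theta_1,\ldots,\theta_n}:=S_{\theta_n}^{(n)}\circ\cdots\circ S_{\theta_1}^{(1)}$, and $\mathcal{S}_{\theta_1,\ldots,\theta_0}:=\mathrm{id}_X$. Products of the spaces $\Theta_k$ carry product $\sigma$-fields. Measures. $\mathcal{M}_1(X)$ is the set of Borel probability measures on $X$; $\mathcal{M}_{1,1}(X)$ is the set of $\mu\in\mathcal{M}_1(X)$ with $\int_X\rho(x,z)\,\mu(dx)<\infty$ for some (equivalently all)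 $z\in X$; $\langle f,\mu\rangle:=\int_X f\,d\mu$. $L_{b,1}(X)$ is the set of functions $f:X\to[-1,1]$ that are Lipschitz with constant at most $1$, and $d_{BL}(\mu,\nu):=\sup_{f\in L_{b,1}(X)}|\langle f,\mu\rangle-\langle f,\nu\rangle|$. Weak convergence $\mu_n\to\mu$ means $\langle f,\mu_n\rangle\to\langle f,\mu\rangle$ for all bounded continuous $f:X\to\mathbb{R}$. Kernels. $P_n(x,A):=\int_{\Theta_n}\mathbf{1}_A(S_\theta^{(n)}(x))\,\vartheta_n(d\theta)$; $\mu P_n(A):=\int_X P_n(x,A)\,\mu(dx)$; $\mu P^{(n)}:=\mu P_1P_2\cdots P_n$ (apply $P_1$ first, then $P_2$, and so on). Thus $\mu P^{(n)}$ is the law of $\Phi_n^\mu=(S_{\eta_n}^{(n)}\circ\cdots\circ S_{\eta_1}^{(1)})(\Phi_0^\mu)$, where $\Phi_0^\mu\sim\mu$, and $\eta_1,\eta_2,\ldots$ are mutually independent, independent of $\Phi_0^\mu$, with $\eta_k\sim\vartheta_k$. *)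

theory Defs
  imports "HOL-Probability.Probability"
begin

section \<open>Borel probability measures on a metric space\<close>

definition borel_probs :: "'a::topological_space measure set" where
  "borel_probs = {\<mu>. sets \<mu> = sets borel \<and> prob_space \<mu>}"

definition borel_probs_1 :: "'a::metric_space measure set" where
  "borel_probs_1 = {\<mu> \<in> borel_probs. \<exists>z. (\<integral>\<^sup>+ x. ennreal (dist x z) \<partial>\<mu>) < \<infinity>}"

definition bounded_lipschitz :: "('a::metric_space \<Rightarrow> real) set" where
  "bounded_lipschitz = {f. range f \<subseteq> {-1..1} \<and> 1-lipschitz_on UNIV f}"

definition dist_BL :: "'a::metric_space measure \<Rightarrow> 'a measure \<Rightarrow> real" where
  "dist_BL \<mu> \<nu> = (SUP f\<in>bounded_lipschitz. \<bar>(\<integral>x. f x \<partial>\<mu>) - (\<integral>x. f x \<partial>\<nu>)\<bar>)"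

definition weakly_converges :: "(nat \<Rightarrow> 'a::topological_space measure) \<Rightarrow> 'a measure \<Rightarrow> bool" where
  "weakly_converges \<mu> \<nu> \<longleftrightarrow>
     (\<forall>f :: 'a \<Rightarrow> real. continuous_on UNIV f \<and> bounded (range f) \<longrightarrow>
        (\<lambda>n. \<integral>x. f x \<partial>\<mu> n) \<longlonglongrightarrow> (\<integral>x. f x \<partial>\<nu>))"

section \<open>Integration\<close>

text \<open>The integral of a quasi-integrable function with values in the extended reals. The Bochner
  integral does not serve here: it is 0 when the negative part of the function has infinite
  integral, while the value should then be \<open>-\<infinity>\<close>.\<close>

definition ext_integral :: "'b measure \<Rightarrow> ('b \<Rightarrow> real) \<Rightarrow> ereal" where
  "ext_integral M f =
     enn2ereal (\<integral>\<^sup>+ x. ennreal (f x) \<partial>M) - enn2ereal (\<integral>\<^sup>+ x. ennreal (- f x) \<partial>M)"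

text \<open>The iterated integral over \<open>\<theta> 1, \<dots>, \<theta> n\<close>, with \<open>\<theta> n\<close> innermost. Tuples
  \<open>(\<theta> 1, \<dots>, \<theta> n)\<close> are functions on \<open>{1..n}\<close> extended by \<open>undefined\<close>, as in
  \<open>space (Pi\<^sub>M {1..n} M)\<close>; the empty tuple is \<open>\<lambda>_. undefined\<close>.\<close>

primrec iterated_nn_integral ::
    "(nat \<Rightarrow> 'b measure) \<Rightarrow> nat \<Rightarrow> ((nat \<Rightarrow> 'b) \<Rightarrow> ennreal) \<Rightarrow> ennreal" where
  "iterated_nn_integral M 0 f = f (\<lambda>_. undefined)"
| "iterated_nn_integral M (Suc n) f =
     iterated_nn_integral M n (\<lambda>\<theta>. \<integral>\<^sup>+ t. f (\<theta>(Suc n := t)) \<partial>M (Suc n))"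

section \<open>Random compositions of maps\<close>

text \<open>The probability space \<open>\<Theta> n\<close> is the space \<open>\<Theta>\<^sub>n\<close> together with its \<open>\<sigma>\<close>-field and its measure,
  and \<open>S n \<theta>\<close> is the \<open>n\<close>-th map with parameter \<open>\<theta>\<close>. All indices start at 1; \<open>\<Theta> 0\<close> and \<open>S 0\<close>
  are never used.\<close>

primrec composed :: "(nat \<Rightarrow> 'b \<Rightarrow> 'a \<Rightarrow> 'a) \<Rightarrow> nat \<Rightarrow> (nat \<Rightarrow> 'b) \<Rightarrow> 'a \<Rightarrow> 'a" where
  "composed S 0 \<theta> = id"
| "composed S (Suc n) \<theta> = S (Suc n) (\<theta> (Suc n)) \<circ> composed S n \<theta>"

definition kernel :: "'b measure \<Rightarrow> ('b \<Rightarrow> 'a \<Rightarrow> 'a) \<Rightarrow> 'a \<Rightarrow> 'a set \<Rightarrow> ennreal" where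
  "kernel M T x A = (\<integral>\<^sup>+ \<theta>. indicator A (T \<theta> x) \<partial>M)"

definition kernel_action ::
    "('a::topological_space \<Rightarrow> 'a set \<Rightarrow> ennreal) \<Rightarrow> 'a measure \<Rightarrow> 'a measure" where
  "kernel_action P \<mu> = measure_of UNIV (sets borel) (\<lambda>A. \<integral>\<^sup>+ x. P x A \<partial>\<mu>)"

primrec law :: "(nat \<Rightarrow> 'b measure) \<Rightarrow> (nat \<Rightarrow> 'b \<Rightarrow> 'a \<Rightarrow> 'a) \<Rightarrow>
    'a::topological_space measure \<Rightarrow> nat \<Rightarrow> 'a measure" where
  "law \<Theta> S \<mu> 0 = \<mu>"
| "law \<Theta> S \<mu> (Suc n) = kernel_action (kernel (\<Theta> (Suc n)) (S (Suc n))) (law \<Theta> S \<mu> n)"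

text \<open>\<open>measure_of\<close> silently yields the zero measure for a set function that is not a measure. The
  next two lemmas show that this does not happen.\<close>

lemma kernel_action_eq_distr:
  fixes \<mu> :: "'a::topological_space measure"
  assumes M: "prob_space M" and \<mu>: "\<mu> \<in> borel_probs"
    and T: "(\<lambda>(x, \<theta>). T \<theta> x) \<in> borel \<Otimes>\<^sub>M M \<rightarrow>\<^sub>M borel"
  shows "kernel_action (kernel M T) \<mu> = distr (\<mu> \<Otimes>\<^sub>M M) borel (\<lambda>(x, \<theta>). T \<theta> x)"
proof (rule measure_eqI)
  interpret M: prob_space M by (rule M)
  have sets_\<mu>: "sets \<mu> = sets borel" using \<mu> by (simp add: borel_probs_def)
  have T': "(\<lambda>(x, \<theta>). T \<theta> x) \<in> \<mu> \<Otimes>\<^sub>M M \<rightarrow>\<^sub>M borel"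
    using T sets_\<mu> by (simp cong: measurable_cong_sets sets_pair_measure_cong)
  let ?D = "distr (\<mu> \<Otimes>\<^sub>M M) borel (\<lambda>(x, \<theta>). T \<theta> x)"
  have key: "emeasure ?D A = (\<integral>\<^sup>+ x. kernel M T x A \<partial>\<mu>)" if A: "A \<in> sets borel" for A
  proof -
    have "emeasure ?D A = (\<integral>\<^sup>+ y. indicator A y \<partial>?D)" using A by simp
    also have "\<dots> = (\<integral>\<^sup>+ z. indicator A ((\<lambda>(x, \<theta>). T \<theta> x) z) \<partial>(\<mu> \<Otimes>\<^sub>M M))"
      using A by (intro nn_integral_distr T') auto
    also have "\<dots> = (\<integral>\<^sup>+ x. \<integral>\<^sup>+ \<theta>. indicator A (T \<theta> x) \<partial>M \<partial>\<mu>)"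
      using measurable_compose[OF T' borel_measurable_indicator[OF A]]
      by (subst M.nn_integral_fst[symmetric]) auto
    finally show ?thesis by (simp add: kernel_def)
  qed
  have sets_act: "sets (kernel_action (kernel M T) \<mu>) = sets borel"
    using sets.sigma_sets_eq[of "borel :: 'a measure"] by (simp add: kernel_action_def)
  then show "sets (kernel_action (kernel M T) \<mu>) = sets ?D" by simp
  fix A assume "A \<in> sets (kernel_action (kernel M T) \<mu>)"
  then have A: "A \<in> sets (borel :: 'a measure)" using sets_act by simp
  have "emeasure (kernel_action (kernel M T) \<mu>) A = (\<integral>\<^sup>+ x. kernel M T x A \<partial>\<mu>)"
  proof (rule emeasure_measure_of[OF kernel_action_def])
    have "countably_additive (sets ?D) (emeasure ?D)" by (rule emeasure_countably_additive)
    then show "countably_additive (sets (kernel_action (kernel M T) \<mu>))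
        (\<lambda>A. \<integral>\<^sup>+ x. kernel M T x A \<partial>\<mu>)"
      unfolding sets_act countably_additive_def
      by (auto simp: key[symmetric] subset_eq image_iff)
  qed (use A sets_act in \<open>auto simp: positive_def kernel_def\<close>)
  then show "emeasure (kernel_action (kernel M T) \<mu>) A = emeasure ?D A" using key[OF A] by simp
qed

lemma law_in_borel_probs:
  assumes "\<And>n. n \<ge> 1 \<Longrightarrow> prob_space (\<Theta> n)"
    and "\<And>n. n \<ge> 1 \<Longrightarrow> (\<lambda>(x, \<theta>). S n \<theta> x) \<in> borel \<Otimes>\<^sub>M \<Theta> n \<rightarrow>\<^sub>M borel"
    and \<mu>: "\<mu> \<in> borel_probs"
  shows "law \<Theta> S \<mu> n \<in> borel_probs"
proof (induction n)
  case (Suc n)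
  interpret M: prob_space "\<Theta> (Suc n)" using assms by simp
  interpret L: prob_space "law \<Theta> S \<mu> n" using Suc by (simp add: borel_probs_def)
  interpret P: pair_prob_space "law \<Theta> S \<mu> n" "\<Theta> (Suc n)" ..
  have sets_L: "sets (law \<Theta> S \<mu> n) = sets borel" using Suc by (simp add: borel_probs_def)
  have "(\<lambda>(x, \<theta>). S (Suc n) \<theta> x) \<in> law \<Theta> S \<mu> n \<Otimes>\<^sub>M \<Theta> (Suc n) \<rightarrow>\<^sub>M borel"
    using assms(2)[of "Suc n"] sets_L by (simp cong: measurable_cong_sets sets_pair_measure_cong)
  from P.prob_space_distr[OF this] show ?case
    using kernel_action_eq_distr[OF M.prob_space_axioms Suc assms(2)[of "Suc n"]]
    by (simp add: borel_probs_def)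
qed (use \<mu> in simp)

text \<open>Tonelli: on measurable functions, the iterated integral is the integral over the product.\<close>

lemma iterated_nn_integral_eq_PiM:
  assumes prob: "\<And>n. n \<ge> 1 \<Longrightarrow> prob_space (M n)" and f: "f \<in> borel_measurable (Pi\<^sub>M {1..n} M)"
  shows "iterated_nn_integral M n f = (\<integral>\<^sup>+ \<theta>. f \<theta> \<partial>Pi\<^sub>M {1..n} M)"
proof -
  define N where "N k = (if k = 0 then M 1 else M k)" for k
  interpret N: product_prob_space N by (rule product_prob_spaceI) (simp add: N_def prob)
  have N_Suc: "N (Suc k) = M (Suc k)" for k by (simp add: N_def)
  have PiM_eq: "Pi\<^sub>M {1..k} M = Pi\<^sub>M {1..k} N" for k by (intro PiM_cong) (auto simp: N_def)
  from f have "f \<in> borel_measurable (Pi\<^sub>M {1..n} N)" by (simp only: PiM_eq)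
  then have "iterated_nn_integral M n f = (\<integral>\<^sup>+ \<theta>. f \<theta> \<partial>Pi\<^sub>M {1..n} N)"
  proof (induction n arbitrary: f)
    case 0
    then show ?case by (simp add: PiM_empty nn_integral_count_space_finite)
  next
    case (Suc n)
    have ins: "{1..Suc n} = insert (Suc n) {1..n}" by auto
    have f: "f \<in> borel_measurable (Pi\<^sub>M (insert (Suc n) {1..n}) N)" using Suc.prems by (simp only: ins)
    note [measurable] = f
    have "(\<lambda>\<theta>. \<integral>\<^sup>+ t. f (\<theta>(Suc n := t)) \<partial>N (Suc n)) \<in> borel_measurable (Pi\<^sub>M {1..n} N)"
      by measurable
    from Suc.IH[OF this] N.product_nn_integral_insert[OF _ _ f] show ?case
      unfolding ins N_Suc iterated_nn_integral.simps by (simp add: fun_upd_def)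
  qed
  then show ?thesis by (simp only: PiM_eq)
qed

end

theory Submission
  imports Defs "HOL-Real_Asymp.Real_Asymp"
begin

text \<open>Let \<open>\<Phi> n\<close> be the composition of the first \<open>n\<close> random maps. Since \<open>L\<close> has finite mean and
  negative logarithmic mean, some moment of order \<open>s \<in> (0, 1]\<close> of \<open>L\<close> is less than 1, so two orbits
  approach each other geometrically in the mean of \<open>dist powr s\<close>. Writing the last map as a conjugate,
  \<open>\<Phi> (n + 1) x\<^sub>0 = \<Phi> n y\<close> with \<open>dist x\<^sub>0 y \<le> M\<close>, the same contraction bounds the distance between
  \<open>\<Phi> n x\<^sub>0\<close> and \<open>\<Phi> (n + 1) x\<^sub>0\<close>. Hence the forward orbit itself converges almost surely, at
  a geometric rate in the mean, and \<open>\<pi>\<close> is the law of its limit.\<close>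

text \<open>Contraction alone makes two forward orbits approach each other but does not make either
  converge, since each new map is applied outermost; usually only the reversed compositions
  converge. The conjugation hypothesis lets the new map act innermost. The obstacle is dependence:
  the displaced point \<open>y\<close> is built from the same parameters as the Lipschitz constant
  \<open>Lip n\<close> of the first \<open>n\<close> maps, so the mean of a power of
  \<open>Lip n * M (Suc n)\<close> does not factorize. At the exponent \<open>s / 2\<close>,
  weighted AM-GM separates it into \<open>Lip n powr s / q ^ n\<close> and
  \<open>q ^ n * M (Suc n) powr s\<close>. For the first term to decay like \<open>q ^ n\<close>,
  the moment of \<open>L\<close> is required to be at most \<open>q\<^sup>2\<close> instead of
  \<open>q\<close>; the second is controlled by the bounded mean of \<open>M\<close>. A random start
  is compared with \<open>x\<^sub>0\<close> separately. There the initial distance and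
  \<open>Lip n\<close> are independent, and the exponent \<open>s\<close> serves directly. A test
  function in \<open>bounded_lipschitz\<close> varies by at most twice any power of the distance
  with exponent in (0, 1], so rates for fractional moments become rates in \<open>dist_BL\<close>
  with the same \<open>q\<close>.\<close>

section \<open>Preliminaries on series, fractional moments and test functions\<close>

lemma summable_dist_imp_convergent:
  fixes f :: "nat \<Rightarrow> 'a::complete_space"
  assumes "summable (\<lambda>n. dist (f n) (f (Suc n)))"
  shows "convergent f"
proof -
  have tri: "dist (f m) (f (m + k)) \<le> (\<Sum>i=m..<m + k. dist (f i) (f (Suc i)))" for m k
  proof (induction k)
    case (Suc k)
    have "dist (f m) (f (m + Suc k)) \<le> dist (f m) (f (m + k)) + dist (f (m + k)) (f (Suc (m + k)))"
      using dist_triangle[of "f m" "f (Suc (m + k))" "f (m + k)"] by simp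
    with Suc show ?case by simp
  qed simp
  have "Cauchy f"
  proof (rule metric_CauchyI)
    fix e :: real assume "e > 0"
    with assms obtain N where N: "\<And>m n. m \<ge> N \<Longrightarrow> norm (\<Sum>i=m..<n. dist (f i) (f (Suc i))) < e"
      unfolding summable_Cauchy by blast
    have *: "dist (f m) (f n) < e" if "N \<le> m" "m \<le> n" for m n
      using tri[of m "n - m"] N[of m n] that by (simp add: le_less_trans)
    have "dist (f m) (f n) < e" if "N \<le> m" "N \<le> n" for m n
      using *[of m n] *[of n m] that by (cases "m \<le> n") (auto simp: dist_commute)
    then show "\<exists>N. \<forall>m\<ge>N. \<forall>n\<ge>N. dist (f m) (f n) < e" by blast
  qed
  then show ?thesis by (rule Cauchy_convergent)
qed

text \<open>Bernoulli's inequality at \<open>x powr (1 / Suc k) - 1\<close>, which is at least -1.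
  The left-hand side approximates \<open>ln x\<close>, and the bound, uniform in \<open>k\<close>,
  provides the nonnegative functions to which Fatou's lemma is applied.\<close>

lemma ln_inverse_power_le:
  fixes x :: real
  assumes "x > 0"
  shows "real (Suc k) * (x powr (1 / real (Suc k)) - 1) \<le> x - 1"
proof -
  have "1 + real (Suc k) * (x powr (1 / real (Suc k)) - 1) \<le> (1 + (x powr (1 / real (Suc k)) - 1)) ^ Suc k"
    by (rule Bernoulli_inequality) simp
  also have "\<dots> = (x powr (1 / real (Suc k))) powr real (Suc k)"
    using assms by (subst powr_realpow) auto
  also have "\<dots> = x" using assms by (simp only: powr_powr) simp
  finally show ?thesis by simp
qed

text \<open>Lets first moments control fractional ones: of \<open>L\<close>, of \<open>M\<close>,
  and of the distance to \<open>x\<^sub>0\<close> under the initial law.\<close>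

lemma powr_le_one_plus:
  fixes x s :: real
  assumes "x \<ge> 0" "0 \<le> s" "s \<le> 1"
  shows "x powr s \<le> 1 + x"
proof (cases "x \<le> 1")
  case True
  then show ?thesis using powr_mono2[of s x 1] assms by simp
next
  case False
  then show ?thesis using powr_mono[of s 1 x] assms by simp
qed

lemma ext_integral_eq_integral:
  assumes "integrable M f"
  shows "ext_integral M f = ereal (integral\<^sup>L M f)"
proof -
  from assms have "(\<integral>\<^sup>+ x. ennreal (f x) \<partial>M) \<noteq> \<infinity>" "(\<integral>\<^sup>+ x. ennreal (- f x) \<partial>M) \<noteq> \<infinity>"
    by (auto simp: real_integrable_def)
  then obtain a b where "(\<integral>\<^sup>+ x. ennreal (f x) \<partial>M) = ennreal a" "(\<integral>\<^sup>+ x. ennreal (- f x) \<partial>M) = ennreal b"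
    "a \<ge> 0" "b \<ge> 0"
    by (metis ennreal_cases infinity_ennreal_def)
  then show ?thesis
    unfolding ext_integral_def real_lebesgue_integral_def[OF assms] by simp
qed

text \<open>If all moments of order \<open>1 / k\<close> were at least 1, Fatou's lemma for
  \<open>X - 1 - k * (X powr (1 / k) - 1) \<ge> 0\<close>, which tends to \<open>X - 1 - ln X\<close>, would give
  \<open>expectation (ln X) \<ge> 0\<close>; it also covers the case of a logarithm with integral \<open>-\<infinity>\<close>.\<close>

lemma (in prob_space) exists_powr_moment_less_one:
  fixes X :: "'a \<Rightarrow> real"
  assumes [measurable]: "X \<in> borel_measurable M"
    and pos: "\<And>\<omega>. \<omega> \<in> space M \<Longrightarrow> X \<omega> > 0"
    and fin: "(\<integral>\<^sup>+ \<omega>. ennreal (X \<omega>) \<partial>M) < \<infinity>"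
    and ln_neg: "ext_integral M (\<lambda>\<omega>. ln (X \<omega>)) < 0"
  shows "\<exists>s. 0 < s \<and> s \<le> 1 \<and> (\<integral>\<^sup>+ \<omega>. ennreal (X \<omega> powr s) \<partial>M) < 1"
proof (rule ccontr)
  assume contra: "\<not> ?thesis"
  define s where "s k = 1 / real (Suc k)" for k
  have s: "0 < s k" "s k \<le> 1" "s k > 0 \<and> s k \<le> 1" for k by (auto simp: s_def)
  have ge1: "(\<integral>\<^sup>+ \<omega>. ennreal (X \<omega> powr s k) \<partial>M) \<ge> 1" for k
    using contra s[of k] by (auto simp: not_less)
  have int_X: "integrable M X"
    using fin pos by (intro integrableI_nonneg) (auto intro: less_imp_le)
  have int_pow: "integrable M (\<lambda>\<omega>. X \<omega> powr s k)" for k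
  proof (rule Bochner_Integration.integrable_bound)
    show "integrable M (\<lambda>\<omega>. 1 + X \<omega>)" using int_X by auto
    show "AE \<omega> in M. norm (X \<omega> powr s k) \<le> norm (1 + X \<omega>)"
      using pos powr_le_one_plus s(1,2)[of k] by (intro AE_I2) (auto simp: less_imp_le abs_of_pos add_pos_pos)
  qed simp
  define g where "g k \<omega> = (X \<omega> - 1) - real (Suc k) * (X \<omega> powr s k - 1)" for k \<omega>
  have [measurable]: "g k \<in> borel_measurable M" for k unfolding g_def by measurable
  have g_nonneg: "g k \<omega> \<ge> 0" if "\<omega> \<in> space M" for k \<omega>
    using ln_inverse_power_le[OF pos[OF that], of k] by (simp add: g_def s_def)
  have int_g: "integrable M (g k)" for k
    unfolding g_def using int_X int_pow[of k] by auto
  \<comment> \<open>The assumption to be refuted enters here: it makes the mean of the subtracted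
    term nonnegative, whatever the factor \<open>Suc k\<close>.\<close>
  have g_bound: "(\<integral>\<^sup>+ \<omega>. ennreal (g k \<omega>) \<partial>M) \<le> ennreal (expectation X - 1)" for k
  proof -
    have "(\<integral>\<^sup>+ \<omega>. ennreal (g k \<omega>) \<partial>M) = ennreal (expectation (g k))"
      using int_g g_nonneg by (intro nn_integral_eq_integral) auto
    also have "expectation (g k) = (expectation X - 1) - real (Suc k) * (expectation (\<lambda>\<omega>. X \<omega> powr s k) - 1)"
      unfolding g_def using int_X int_pow[of k] by (simp add: prob_space)
    also have "expectation (\<lambda>\<omega>. X \<omega> powr s k) \<ge> 1"
      using ge1[of k] nn_integral_eq_integral[OF int_pow[of k]] by simp
    then have "ennreal ((expectation X - 1) - real (Suc k) * (expectation (\<lambda>\<omega>. X \<omega> powr s k) - 1))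
        \<le> ennreal (expectation X - 1)"
      by (intro ennreal_leI) (simp del: of_nat_Suc)
    finally show ?thesis .
  qed
  define h where "h \<omega> = X \<omega> - 1 - ln (X \<omega>)" for \<omega>
  have [measurable]: "h \<in> borel_measurable M" unfolding h_def by measurable
  have h_nonneg: "h \<omega> \<ge> 0" if "\<omega> \<in> space M" for \<omega>
    using ln_le_minus_one[OF pos[OF that]] by (simp add: h_def)
  have lim: "(\<lambda>k. g k \<omega>) \<longlonglongrightarrow> h \<omega>" if "\<omega> \<in> space M" for \<omega>
  proof -
    have "(\<lambda>k. real (Suc k) * (x powr (1 / real (Suc k)) - 1)) \<longlonglongrightarrow> ln x" if "x > 0" for x :: real
      using that by real_asymp
    from tendsto_diff[OF tendsto_const this[OF pos[OF that]]] show ?thesis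
      unfolding g_def h_def s_def .
  qed
  have "(\<integral>\<^sup>+ \<omega>. ennreal (h \<omega>) \<partial>M) = (\<integral>\<^sup>+ \<omega>. liminf (\<lambda>k. ennreal (g k \<omega>)) \<partial>M)"
    by (intro nn_integral_cong lim_imp_Liminf[symmetric]) (auto intro!: tendsto_ennrealI lim)
  also have "\<dots> \<le> liminf (\<lambda>k. \<integral>\<^sup>+ \<omega>. ennreal (g k \<omega>) \<partial>M)"
    by (rule nn_integral_liminf) simp
  also have "\<dots> \<le> ennreal (expectation X - 1)"
    using g_bound by (intro Liminf_le) auto
  finally have h_le: "(\<integral>\<^sup>+ \<omega>. ennreal (h \<omega>) \<partial>M) \<le> ennreal (expectation X - 1)" .
  have int_h: "integrable M h"
    using h_le h_nonneg by (intro integrableI_nonneg) (auto intro: le_less_trans)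
  \<comment> \<open>\<open>ennreal\<close> cuts negative reals to 0, so \<open>h_le\<close> becomes
    a real inequality only once its right-hand side is nonnegative. As \<open>s 0 = 1\<close>, this
    is \<open>ge1\<close> at 0.\<close>
  have "expectation X - 1 \<ge> 0"
  proof -
    have "1 \<le> (\<integral>\<^sup>+ \<omega>. ennreal (X \<omega>) \<partial>M)"
      using ge1[of 0] pos by (simp add: s_def less_imp_le cong: nn_integral_cong)
    also have "\<dots> = ennreal (expectation X)"
      using int_X pos by (intro nn_integral_eq_integral) (auto simp: less_imp_le)
    finally show ?thesis by simp
  qed
  then have "expectation h \<le> expectation X - 1"
    using h_le nn_integral_eq_integral[OF int_h] h_nonneg by (simp add: AE_I2)
  moreover have "integrable M (\<lambda>\<omega>. (X \<omega> - 1) - h \<omega>)"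
    using int_X int_h by auto
  \<comment> \<open>This rules out a logarithmic mean of minus infinity, so
    \<open>ext_integral\<close> is an ordinary expectation from here on.\<close>
  then have int_ln: "integrable M (\<lambda>\<omega>. ln (X \<omega>))" by (simp add: h_def)
  have "expectation h = expectation X - 1 - expectation (\<lambda>\<omega>. ln (X \<omega>))"
    unfolding h_def using int_X int_ln by (simp add: prob_space)
  ultimately have "expectation (\<lambda>\<omega>. ln (X \<omega>)) \<ge> 0" by simp
  with ln_neg ext_integral_eq_integral[OF int_ln] show False by simp
qed

text \<open>Tonelli makes the series of \<open>Y n \<omega> powr t\<close> finite almost surely. Its
  terms are then eventually below 1, where \<open>t \<le> 1\<close> gives
  \<open>Y n \<omega> \<le> Y n \<omega> powr t\<close>.\<close>

lemma AE_summable_of_powr_moments: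
  fixes Y :: "nat \<Rightarrow> 'b \<Rightarrow> real"
  assumes [measurable]: "\<And>n. Y n \<in> borel_measurable M"
    and nonneg: "\<And>n \<omega>. Y n \<omega> \<ge> 0"
    and t: "0 < t" "t \<le> 1" and q: "0 \<le> q" "q < 1" and K: "K \<ge> 0"
    and bound: "\<And>n. (\<integral>\<^sup>+ \<omega>. ennreal (Y n \<omega> powr t) \<partial>M) \<le> ennreal (K * q ^ n)"
  shows "AE \<omega> in M. summable (\<lambda>n. Y n \<omega>)"
proof -
  have "(\<integral>\<^sup>+ \<omega>. (\<Sum>n. ennreal (Y n \<omega> powr t)) \<partial>M) = (\<Sum>n. \<integral>\<^sup>+ \<omega>. ennreal (Y n \<omega> powr t) \<partial>M)"
    by (rule nn_integral_suminf) simp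
  also have "\<dots> \<le> (\<Sum>n. ennreal (K * q ^ n))"
    by (intro suminf_le bound) auto
  also have "\<dots> < \<infinity>"
    using q K by (subst suminf_ennreal2) (auto intro!: summable_mult summable_geometric)
  finally have "(\<integral>\<^sup>+ \<omega>. (\<Sum>n. ennreal (Y n \<omega> powr t)) \<partial>M) \<noteq> \<infinity>" by simp
  then have "AE \<omega> in M. (\<Sum>n. ennreal (Y n \<omega> powr t)) \<noteq> \<infinity>"
    by (intro nn_integral_PInf_AE) measurable
  then show ?thesis
  proof (rule AE_mp, intro AE_I2 impI)
    fix \<omega> assume "(\<Sum>n. ennreal (Y n \<omega> powr t)) \<noteq> \<infinity>"
    then have sum: "summable (\<lambda>n. Y n \<omega> powr t)"
      by (intro summable_suminf_not_top) auto
    then have "\<forall>\<^sub>F n in sequentially. Y n \<omega> powr t < 1"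
      by (intro order_tendstoD[OF summable_LIMSEQ_zero]) auto
    then have "\<forall>\<^sub>F n in sequentially. norm (Y n \<omega>) \<le> Y n \<omega> powr t"
    proof eventually_elim
      case (elim n)
      have "Y n \<omega> \<le> 1"
      proof (rule ccontr)
        assume "\<not> Y n \<omega> \<le> 1"
        then have "Y n \<omega> powr t \<ge> 1" using t by (intro ge_one_powr_ge_zero) auto
        with elim show False by simp
      qed
      then show ?case using nonneg[of n \<omega>] t powr_mono'[of t 1 "Y n \<omega>"] by (cases "Y n \<omega> = 0") auto
    qed
    then show "summable (\<lambda>n. Y n \<omega>)" using sum by (rule summable_comparison_test_ev)
  qed
qed

text \<open>At distance at most 1 the Lipschitz bound is the stronger one; beyond that, the
  oscillation is at most 2 and the power is at least 1.\<close>

lemma bounded_lipschitz_le_powr: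
  fixes f :: "'a::metric_space \<Rightarrow> real"
  assumes f: "f \<in> bounded_lipschitz" and t: "0 < t" "t \<le> 1"
  shows "\<bar>f x - f y\<bar> \<le> 2 * dist x y powr t"
proof (cases "dist x y \<le> 1")
  case True
  have "\<bar>f x - f y\<bar> \<le> dist x y"
    using f lipschitz_onD[of 1 UNIV f x y] by (simp add: bounded_lipschitz_def dist_real_def)
  also have "\<dots> \<le> dist x y powr t" using True t powr_mono'[of t 1 "dist x y"] by (cases "x = y") auto
  finally show ?thesis by simp
next
  case False
  have "f x \<in> {-1..1}" "f y \<in> {-1..1}" using f unfolding bounded_lipschitz_def by blast+
  then have "\<bar>f x - f y\<bar> \<le> 2" by auto
  moreover have "dist x y powr t \<ge> 1" using False t by (intro ge_one_powr_ge_zero) auto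
  ultimately show ?thesis by simp
qed

lemma (in pair_prob_space) distr_pair_snd: "distr (M1 \<Otimes>\<^sub>M M2) M2 snd = M2"
proof (rule measure_eqI)
  fix A assume "A \<in> sets (distr (M1 \<Otimes>\<^sub>M M2) M2 snd)"
  then have A: "A \<in> sets M2" by simp
  then have "snd -` A \<inter> space (M1 \<Otimes>\<^sub>M M2) = space M1 \<times> A"
    using sets.sets_into_space[OF A] by (auto simp: space_pair_measure)
  then show "emeasure (distr (M1 \<Otimes>\<^sub>M M2) M2 snd) A = emeasure M2 A"
    using A by (simp add: emeasure_distr M2.emeasure_pair_measure_Times M1.emeasure_space_1)
qed simp

lemma (in pair_prob_space) AE_pair_snd:
  assumes "AE y in M2. Q y"
  shows "AE z in M1 \<Otimes>\<^sub>M M2. Q (snd z)"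
proof (rule AE_distrD[where P = Q])
  show "AE y in distr (M1 \<Otimes>\<^sub>M M2) M2 snd. Q y" unfolding distr_pair_snd by fact
qed measurable

lemma abs_diff_limit_le_geometric:
  fixes a :: "nat \<Rightarrow> real"
  assumes step: "\<And>n. n \<ge> N \<Longrightarrow> \<bar>a (Suc n) - a n\<bar> \<le> K * q ^ n"
    and lim: "a \<longlonglongrightarrow> l" and q: "0 \<le> q" "q < 1" and K: "K \<ge> 0" and n: "n \<ge> N"
  shows "\<bar>a n - l\<bar> \<le> K / (1 - q) * q ^ n"
proof -
  \<comment> \<open>The exact geometric partial sum is kept because the bound without
    \<open>q ^ (n + m)\<close> would not pass through the induction.\<close>
  have *: "\<bar>a (n + m) - a n\<bar> \<le> K / (1 - q) * (q ^ n - q ^ (n + m))" for m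
  proof (induction m)
    case (Suc m)
    have "K * q ^ (n + m) = K / (1 - q) * (q ^ (n + m) - q ^ (n + Suc m))"
      using q by (simp add: field_simps)
    with step[of "n + m"] Suc n show ?case by (simp add: algebra_simps)
  qed simp
  have "\<bar>a (n + m) - a n\<bar> \<le> K / (1 - q) * q ^ n" for m
    using q K by (intro order.trans[OF *] mult_left_mono) auto
  moreover have "(\<lambda>m. \<bar>a (n + m) - a n\<bar>) \<longlonglongrightarrow> \<bar>l - a n\<bar>"
    using LIMSEQ_ignore_initial_segment[OF lim, of n] by (intro tendsto_intros) (simp add: add.commute)
  ultimately have "\<bar>l - a n\<bar> \<le> K / (1 - q) * q ^ n"
    by (intro LIMSEQ_le_const2) auto
  then show ?thesis by (simp add: abs_minus_commute)
qed

lemma bounded_lipschitz_measurable: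
  fixes f :: "'a::metric_space \<Rightarrow> real"
  shows "f \<in> bounded_lipschitz \<Longrightarrow> f \<in> borel_measurable borel"
  unfolding bounded_lipschitz_def
  by (auto intro: borel_measurable_continuous_onI lipschitz_on_continuous_on)

lemma bounded_lipschitz_abs_le: "f \<in> bounded_lipschitz \<Longrightarrow> \<bar>f x\<bar> \<le> 1"
  unfolding bounded_lipschitz_def by (auto simp: abs_le_iff image_subset_iff)

lemma (in finite_measure) abs_integral_le:
  fixes f :: "'a \<Rightarrow> real"
  assumes "f \<in> borel_measurable M" "(\<integral>\<^sup>+ x. ennreal \<bar>f x\<bar> \<partial>M) \<le> ennreal c" "c \<ge> 0"
  shows "\<bar>integral\<^sup>L M f\<bar> \<le> c"
proof -
  have "(\<integral>\<^sup>+ x. ennreal (norm (f x)) \<partial>M) < \<infinity>"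
    using assms(2) by (auto intro: le_less_trans)
  then have "integrable M f" using assms(1) by (intro integrableI_bounded) auto
  then have "ennreal (norm (integral\<^sup>L M f)) \<le> (\<integral>\<^sup>+ x. ennreal (norm (f x)) \<partial>M)"
    by (rule integral_norm_bound_ennreal)
  also have "\<dots> \<le> ennreal c" using assms(2) by simp
  finally have "ennreal (norm (integral\<^sup>L M f)) \<le> ennreal c" .
  then show ?thesis using assms(3) by simp
qed

lemma dist_BL_le:
  assumes "\<And>f. f \<in> bounded_lipschitz \<Longrightarrow> \<bar>(\<integral>x. f x \<partial>\<mu>) - (\<integral>x. f x \<partial>\<nu>)\<bar> \<le> c"
  shows "dist_BL \<mu> \<nu> \<le> c"
proof -
  have "(\<lambda>_. 0) \<in> bounded_lipschitz" by (auto simp: bounded_lipschitz_def lipschitz_on_def)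
  then show ?thesis unfolding dist_BL_def using assms by (intro cSUP_least) auto
qed

text \<open>The crude bound for the finitely many \<open>n\<close> below the index from which
  increments are controlled.\<close>

lemma abs_integral_diff_le_2:
  assumes "\<mu> \<in> borel_probs" "\<nu> \<in> borel_probs" "f \<in> bounded_lipschitz"
  shows "\<bar>(\<integral>x. f x \<partial>\<mu>) - (\<integral>x. f x \<partial>\<nu>)\<bar> \<le> 2"
proof -
  have "\<bar>\<integral>x. f x \<partial>\<mu>\<bar> \<le> 1" if "\<mu> \<in> borel_probs" for \<mu>
  proof -
    interpret prob_space \<mu> using that by (simp add: borel_probs_def)
    have "(\<integral>\<^sup>+ x. ennreal \<bar>f x\<bar> \<partial>\<mu>) \<le> (\<integral>\<^sup>+ x. 1 \<partial>\<mu>)"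
      by (intro nn_integral_mono) (simp add: bounded_lipschitz_abs_le[OF assms(3)])
    then show ?thesis
      using that bounded_lipschitz_measurable[OF assms(3)]
      by (intro abs_integral_le) (auto simp: borel_probs_def emeasure_space_1 cong: measurable_cong_sets)
  qed
  from this[OF assms(1)] this[OF assms(2)] show ?thesis by linarith
qed

text \<open>The triangle inequality changes the base point. Hence the Bochner integral of
  \<open>dist x x\<^sub>0\<close> in the final estimate is the true first moment and not the default
  value 0.\<close>

lemma borel_probs_1_integrable_dist:
  fixes \<mu> :: "'a::{metric_space, second_countable_topology} measure"
  assumes "\<mu> \<in> borel_probs_1"
  shows "integrable \<mu> (\<lambda>x. dist x y)"
proof -
  obtain z where z: "(\<integral>\<^sup>+ x. ennreal (dist x z) \<partial>\<mu>) < \<infinity>" and \<mu>: "sets \<mu> = sets borel" "prob_space \<mu>"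
    using assms by (auto simp: borel_probs_1_def borel_probs_def)
  interpret prob_space \<mu> by fact
  have meas: "(\<lambda>x. dist x w) \<in> borel_measurable \<mu>" for w
    using \<mu>(1) by (simp cong: measurable_cong_sets)
  have "integrable \<mu> (\<lambda>x. dist x z)"
    using z meas by (intro integrableI_nonneg) auto
  then have "integrable \<mu> (\<lambda>x. dist x z + dist z y)" by simp
  then show ?thesis
    by (rule Bochner_Integration.integrable_bound) (auto intro: meas dist_triangle)
qed

section \<open>Random compositions and their laws\<close>

text \<open>Allows passing between an infinite parameter sequence, its restriction to finitely many
  coordinates, and a tuple whose next coordinate is overwritten.\<close>

lemma composed_cong:
  assumes "\<And>k. k \<in> {1..n} \<Longrightarrow> \<theta> k = \<theta>' k"
  shows "composed S n \<theta> = composed S n \<theta>'"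
  using assms by (induction n) auto

text \<open>Index 0 is included in \<open>prob\<close> because all parameters are put on one
  infinite product over \<open>UNIV\<close>. All compositions are then random variables on the same
  space, so almost sure convergence of an orbit makes sense.\<close>

locale random_maps =
  fixes \<Theta> :: "nat \<Rightarrow> 'b measure" and S :: "nat \<Rightarrow> 'b \<Rightarrow> 'a::polish_space \<Rightarrow> 'a"
  assumes prob: "\<And>n. prob_space (\<Theta> n)"
    and S_measurable: "\<And>n. n \<ge> 1 \<Longrightarrow> (\<lambda>(x, \<theta>). S n \<theta> x) \<in> borel \<Otimes>\<^sub>M \<Theta> n \<rightarrow>\<^sub>M borel"
begin

sublocale product_prob_space \<Theta> UNIV
  by (rule product_prob_spaceI) (rule prob)

abbreviation P :: "(nat \<Rightarrow> 'b) measure" where "P \<equiv> Pi\<^sub>M UNIV \<Theta>"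

text \<open>The index set is left open so as to cover both finite tuples and the infinite product;
  measurability is joint because the initial point will be random.\<close>

lemma composed_measurable_pair:
  assumes "{1..n} \<subseteq> I"
  shows "(\<lambda>z. composed S n (snd z) (fst z)) \<in> borel \<Otimes>\<^sub>M Pi\<^sub>M I \<Theta> \<rightarrow>\<^sub>M borel"
  using assms
proof (induction n)
  case (Suc n)
  from Suc.prems have "{1..n} \<subseteq> I" by (rule order.trans[rotated]) auto
  note [measurable] = Suc.IH[OF this]
  have [measurable]: "(\<lambda>z. snd z (Suc n)) \<in> borel \<Otimes>\<^sub>M Pi\<^sub>M I \<Theta> \<rightarrow>\<^sub>M \<Theta> (Suc n)"
    using Suc.prems by (intro measurable_compose[OF measurable_snd] measurable_component_singleton) auto
  have "(\<lambda>z. (composed S n (snd z) (fst z), snd z (Suc n))) \<in> borel \<Otimes>\<^sub>M Pi\<^sub>M I \<Theta> \<rightarrow>\<^sub>M borel \<Otimes>\<^sub>M \<Theta> (Suc n)"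
    by measurable
  from measurable_compose[OF this S_measurable[of "Suc n"]] show ?case by simp
qed simp

lemma composed_measurable:
  assumes "{1..n} \<subseteq> I"
  shows "(\<lambda>\<omega>. composed S n \<omega> x) \<in> Pi\<^sub>M I \<Theta> \<rightarrow>\<^sub>M borel"
  using measurable_compose[OF measurable_Pair1' composed_measurable_pair[OF assms], of x] by simp

text \<open>The finite product is the marginal of \<open>P\<close> on \<open>J\<close>; this moves
  integrals over tuples to infinite sequences.\<close>

lemma nn_integral_PiM_restrict:
  assumes f: "f \<in> borel_measurable (Pi\<^sub>M J \<Theta>)" and "finite J"
    and "\<And>\<omega>. \<omega> \<in> space P \<Longrightarrow> f (restrict \<omega> J) = g \<omega>"
  shows "(\<integral>\<^sup>+ \<omega>. f \<omega> \<partial>Pi\<^sub>M J \<Theta>) = (\<integral>\<^sup>+ \<omega>. g \<omega> \<partial>P)"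
proof -
  have "(\<integral>\<^sup>+ \<omega>. f \<omega> \<partial>Pi\<^sub>M J \<Theta>) = (\<integral>\<^sup>+ \<omega>. f \<omega> \<partial>distr P (Pi\<^sub>M J \<Theta>) (\<lambda>\<omega>. restrict \<omega> J))"
    using assms(2) by (subst distr_PiM_restrict_finite) auto
  also have "\<dots> = (\<integral>\<^sup>+ \<omega>. f (restrict \<omega> J) \<partial>P)"
    using f by (intro nn_integral_distr) (auto intro: measurable_restrict_subset)
  also have "\<dots> = (\<integral>\<^sup>+ \<omega>. g \<omega> \<partial>P)"
    using assms(3) by (intro nn_integral_cong)
  finally show ?thesis .
qed

lemma AE_PiM_restrict:
  assumes "AE \<theta> in Pi\<^sub>M J \<Theta>. Q \<theta>" "finite J"
  shows "AE \<omega> in P. Q (restrict \<omega> J)"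
proof (rule AE_distrD[where P = Q])
  show "(\<lambda>\<omega>. restrict \<omega> J) \<in> P \<rightarrow>\<^sub>M Pi\<^sub>M J \<Theta>"
    by (rule measurable_restrict_subset) simp
  show "AE \<theta> in distr P (Pi\<^sub>M J \<Theta>) (\<lambda>\<omega>. restrict \<omega> J). Q \<theta>"
    using assms by (subst distr_PiM_restrict_finite) auto
qed

text \<open>The last kernel is absorbed into the test function: the induction hypothesis is applied
  to the average of \<open>g\<close> over the last map, which is why \<open>g\<close> varies in the
  induction.\<close>

lemma nn_integral_law:
  assumes \<mu>: "\<mu> \<in> borel_probs" and "g \<in> borel_measurable borel"
  shows "(\<integral>\<^sup>+ x. g x \<partial>law \<Theta> S \<mu> n) = (\<integral>\<^sup>+ x. \<integral>\<^sup>+ \<theta>. g (composed S n \<theta> x) \<partial>Pi\<^sub>M {1..n} \<Theta> \<partial>\<mu>)"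
  using assms(2)
proof (induction n arbitrary: g)
  case 0
  then show ?case by (simp add: PiM_empty nn_integral_count_space_finite)
next
  case (Suc n)
  let ?\<nu> = "law \<Theta> S \<mu> n" and ?T = "\<Theta> (Suc n)"
  note [measurable] = Suc.prems
  have \<nu>: "?\<nu> \<in> borel_probs"
    by (rule law_in_borel_probs[OF prob S_measurable \<mu>])
  then have sets_\<nu>: "sets ?\<nu> = sets borel" by (simp add: borel_probs_def)
  have S': "(\<lambda>(x, \<theta>). S (Suc n) \<theta> x) \<in> borel \<Otimes>\<^sub>M ?T \<rightarrow>\<^sub>M borel"
    by (rule S_measurable) simp
  then have S'': "(\<lambda>(x, \<theta>). S (Suc n) \<theta> x) \<in> ?\<nu> \<Otimes>\<^sub>M ?T \<rightarrow>\<^sub>M borel"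
    using sets_\<nu> by (simp cong: measurable_cong_sets sets_pair_measure_cong)
  have h[measurable]: "(\<lambda>y. \<integral>\<^sup>+ t. g (S (Suc n) t y) \<partial>?T) \<in> borel_measurable borel"
    using measurable_compose[OF S' Suc.prems]
    by (intro sigma_finite_measure.borel_measurable_nn_integral prob_space_imp_sigma_finite prob) (simp add: case_prod_beta')
  have ins: "{1..Suc n} = insert (Suc n) {1..n}" by auto
  have "(\<integral>\<^sup>+ x. g x \<partial>law \<Theta> S \<mu> (Suc n)) = (\<integral>\<^sup>+ z. g (case z of (x, \<theta>) \<Rightarrow> S (Suc n) \<theta> x) \<partial>(?\<nu> \<Otimes>\<^sub>M ?T))"
    using S'' by (simp add: kernel_action_eq_distr[OF prob \<nu> S'] nn_integral_distr)
  also have "\<dots> = (\<integral>\<^sup>+ y. \<integral>\<^sup>+ t. g (S (Suc n) t y) \<partial>?T \<partial>?\<nu>)"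
    using measurable_compose[OF S'' Suc.prems]
    by (subst sigma_finite_measure.nn_integral_fst[OF prob_space_imp_sigma_finite[OF prob], symmetric]) auto
  also have "\<dots> = (\<integral>\<^sup>+ x. \<integral>\<^sup>+ \<theta>. \<integral>\<^sup>+ t. g (S (Suc n) t (composed S n \<theta> x)) \<partial>?T \<partial>Pi\<^sub>M {1..n} \<Theta> \<partial>\<mu>)"
    by (rule Suc.IH) (rule h)
  also have "\<dots> = (\<integral>\<^sup>+ x. \<integral>\<^sup>+ \<theta>. g (composed S (Suc n) \<theta> x) \<partial>Pi\<^sub>M {1..Suc n} \<Theta> \<partial>\<mu>)"
  proof (rule nn_integral_cong)
    fix x
    have "(\<lambda>\<theta>. g (composed S (Suc n) \<theta> x)) \<in> borel_measurable (Pi\<^sub>M (insert (Suc n) {1..n}) \<Theta>)"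
      by (rule measurable_compose[OF composed_measurable Suc.prems]) auto
    moreover have "composed S n (\<theta>(Suc n := t)) = composed S n \<theta>" for \<theta> t
      by (rule composed_cong) auto
    ultimately show "(\<integral>\<^sup>+ \<theta>. \<integral>\<^sup>+ t. g (S (Suc n) t (composed S n \<theta> x)) \<partial>?T \<partial>Pi\<^sub>M {1..n} \<Theta>)
        = (\<integral>\<^sup>+ \<theta>. g (composed S (Suc n) \<theta> x) \<partial>Pi\<^sub>M {1..Suc n} \<Theta>)"
      unfolding ins by (subst product_nn_integral_insert) auto
  qed
  finally show ?case .
qed

lemma composed_measurable_pair':
  assumes "sets \<mu> = sets borel"
  shows "(\<lambda>z. composed S n (snd z) (fst z)) \<in> \<mu> \<Otimes>\<^sub>M P \<rightarrow>\<^sub>M borel"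
  using composed_measurable_pair[of n UNIV] assms
  by (simp cong: measurable_cong_sets sets_pair_measure_cong)

text \<open>A coupling: one parameter sequence, independent of the initial point, realizes the laws
  for all \<open>n\<close>, so that laws can be compared path by path.\<close>

lemma law_eq_distr:
  assumes \<mu>: "\<mu> \<in> borel_probs"
  shows "law \<Theta> S \<mu> n = distr (\<mu> \<Otimes>\<^sub>M P) borel (\<lambda>z. composed S n (snd z) (fst z))"
proof (rule measure_eqI)
  have sets_\<mu>: "sets \<mu> = sets borel" using \<mu> by (simp add: borel_probs_def)
  note Phi = composed_measurable_pair'[OF sets_\<mu>, of n]
  have sets_law: "sets (law \<Theta> S \<mu> n) = sets borel"
    using law_in_borel_probs[OF prob S_measurable \<mu>, of "\<lambda>n. n" n] by (simp add: borel_probs_def)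
  then show "sets (law \<Theta> S \<mu> n) = sets (distr (\<mu> \<Otimes>\<^sub>M P) borel (\<lambda>z. composed S n (snd z) (fst z)))"
    by simp
  fix A assume "A \<in> sets (law \<Theta> S \<mu> n)"
  then have A: "A \<in> sets borel" using sets_law by simp
  then have ind: "(indicator A :: 'a \<Rightarrow> ennreal) \<in> borel_measurable borel" by simp
  have "emeasure (law \<Theta> S \<mu> n) A = (\<integral>\<^sup>+ x. indicator A x \<partial>law \<Theta> S \<mu> n)"
    using A sets_law by simp
  also have "\<dots> = (\<integral>\<^sup>+ x. \<integral>\<^sup>+ \<theta>. indicator A (composed S n \<theta> x) \<partial>Pi\<^sub>M {1..n} \<Theta> \<partial>\<mu>)"
    by (rule nn_integral_law[OF \<mu> ind])
  also have "\<dots> = (\<integral>\<^sup>+ x. \<integral>\<^sup>+ \<omega>. indicator A (composed S n \<omega> x) \<partial>P \<partial>\<mu>)"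
  proof (intro nn_integral_cong nn_integral_PiM_restrict)
    show "(\<lambda>\<theta>. indicator A (composed S n \<theta> x) :: ennreal) \<in> borel_measurable (Pi\<^sub>M {1..n} \<Theta>)" for x
      by (rule measurable_compose[OF composed_measurable ind]) auto
    show "indicator A (composed S n (restrict \<omega> {1..n}) x) = (indicator A (composed S n \<omega> x) :: ennreal)" for \<omega> x
      by (subst composed_cong[of n _ \<omega>]) auto
  qed auto
  also have "\<dots> = (\<integral>\<^sup>+ z. indicator A (composed S n (snd z) (fst z)) \<partial>(\<mu> \<Otimes>\<^sub>M P))"
    using measurable_compose[OF Phi ind] by (subst P.nn_integral_fst[symmetric]) auto
  also have "\<dots> = (\<integral>\<^sup>+ y. indicator A y \<partial>distr (\<mu> \<Otimes>\<^sub>M P) borel (\<lambda>z. composed S n (snd z) (fst z)))"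
    using Phi ind by (subst nn_integral_distr) auto
  also have "\<dots> = emeasure (distr (\<mu> \<Otimes>\<^sub>M P) borel (\<lambda>z. composed S n (snd z) (fst z))) A"
    using A by simp
  finally show "emeasure (law \<Theta> S \<mu> n) A = \<dots>" .
qed

end

section \<open>Contraction in the mean\<close>

text \<open>One pair \<open>s\<close>, \<open>q\<close> serves all indices. The bound
  \<open>q\<^sup>2\<close> leaves a spare factor \<open>q\<close> per step, spent on the weight in
  the AM-GM estimate of the increments.\<close>

locale contracting_maps = random_maps \<Theta> S
  for \<Theta> :: "nat \<Rightarrow> 'b measure" and S :: "nat \<Rightarrow> 'b \<Rightarrow> 'a::polish_space \<Rightarrow> 'a" +
  fixes L :: "nat \<Rightarrow> 'b \<Rightarrow> real" and s q :: real
  assumes L_measurable[measurable]: "\<And>n. n \<ge> 1 \<Longrightarrow> L n \<in> borel_measurable (\<Theta> n)"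
    and L_pos: "\<And>n \<theta>. n \<ge> 1 \<Longrightarrow> \<theta> \<in> space (\<Theta> n) \<Longrightarrow> L n \<theta> > 0"
    and lipschitz: "\<And>n. n \<ge> 1 \<Longrightarrow>
      AE \<theta> in \<Theta> n. \<forall>x y. dist (S n \<theta> x) (S n \<theta> y) \<le> L n \<theta> * dist x y"
    and s: "0 < s" "s \<le> 1" and q: "0 < q" "q < 1"
    and L_moment: "\<And>n. n \<ge> 1 \<Longrightarrow> (\<integral>\<^sup>+ \<theta>. ennreal (L n \<theta> powr s) \<partial>\<Theta> n) \<le> ennreal (q\<^sup>2)"
begin

definition Lip :: "nat \<Rightarrow> (nat \<Rightarrow> 'b) \<Rightarrow> real" where
  "Lip n \<omega> = (\<Prod>k\<in>{1..n}. L k (\<omega> k))"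

lemma Lip_measurable:
  assumes "{1..n} \<subseteq> I"
  shows "Lip n \<in> borel_measurable (Pi\<^sub>M I \<Theta>)"
  unfolding Lip_def
proof (rule borel_measurable_prod)
  fix k assume "k \<in> {1..n}"
  then show "(\<lambda>\<omega>. L k (\<omega> k)) \<in> borel_measurable (Pi\<^sub>M I \<Theta>)"
    using assms by (intro measurable_compose[OF measurable_component_singleton[where M = \<Theta> and i = k] L_measurable]) auto
qed

lemmas [measurable] = Lip_measurable[OF subset_UNIV]

lemma Lip_pos: "\<omega> \<in> space P \<Longrightarrow> Lip n \<omega> > 0"
  unfolding Lip_def by (intro prod_pos) (auto intro!: L_pos simp: space_PiM PiE_iff)

text \<open>The coordinates are independent, so the moment of the product factorizes.\<close>

lemma Lip_moment: "(\<integral>\<^sup>+ \<omega>. ennreal (Lip n \<omega> powr s) \<partial>P) \<le> ennreal (q ^ n * q ^ n)"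
proof -
  have "(\<integral>\<^sup>+ \<omega>. ennreal (Lip n \<omega> powr s) \<partial>P) = (\<integral>\<^sup>+ \<theta>. (\<Prod>k\<in>{1..n}. ennreal (L k (\<theta> k) powr s)) \<partial>Pi\<^sub>M {1..n} \<Theta>)"
  proof (rule nn_integral_PiM_restrict[symmetric])
    show "(\<lambda>\<theta>. \<Prod>k\<in>{1..n}. ennreal (L k (\<theta> k) powr s)) \<in> borel_measurable (Pi\<^sub>M {1..n} \<Theta>)"
    proof (rule borel_measurable_prod_ennreal)
      fix k assume "k \<in> {1..n}"
      then have [measurable]: "(\<lambda>\<omega>. L k (\<omega> k)) \<in> borel_measurable (Pi\<^sub>M {1..n} \<Theta>)"
        by (intro measurable_compose[OF measurable_component_singleton[where M = \<Theta> and i = k] L_measurable]) auto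
      show "(\<lambda>\<theta>. ennreal (L k (\<theta> k) powr s)) \<in> borel_measurable (Pi\<^sub>M {1..n} \<Theta>)" by measurable
    qed
    fix \<omega> assume "\<omega> \<in> space P"
    then have "L k (\<omega> k) \<ge> 0" if "k \<in> {1..n}" for k
      using that by (intro less_imp_le[OF L_pos]) (auto simp: space_PiM PiE_iff)
    then show "(\<Prod>k\<in>{1..n}. ennreal (L k (restrict \<omega> {1..n} k) powr s)) = ennreal (Lip n \<omega> powr s)"
      unfolding Lip_def by (simp add: prod_powr_distrib prod_ennreal)
  qed simp
  also have "\<dots> = (\<Prod>k\<in>{1..n}. \<integral>\<^sup>+ \<theta>. ennreal (L k \<theta> powr s) \<partial>\<Theta> k)"
    by (intro product_nn_integral_prod) auto
  also have "\<dots> \<le> (\<Prod>k\<in>{1..n}. ennreal (q\<^sup>2))"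
    by (intro prod_mono_ennreal L_moment) auto
  also have "\<dots> = ennreal (q ^ n * q ^ n)"
    using q by (simp add: ennreal_power power_mult[symmetric] power_add[symmetric] mult_2)
  finally show ?thesis .
qed

text \<open>A countable union of null sets serves all indices at once; the points are already
  quantified inside the almost sure hypothesis.\<close>

lemma AE_composed_lipschitz:
  "AE \<omega> in P. \<forall>n x y. dist (composed S n \<omega> x) (composed S n \<omega> y) \<le> Lip n \<omega> * dist x y"
proof -
  have "AE \<omega> in P. \<forall>n. n \<ge> 1 \<longrightarrow> (\<forall>x y. dist (S n (\<omega> n) x) (S n (\<omega> n) y) \<le> L n (\<omega> n) * dist x y)"
    unfolding AE_all_countable
  proof (intro allI AE_impI)
    fix n :: nat assume "n \<ge> 1"
    then show "AE \<omega> in P. \<forall>x y. dist (S n (\<omega> n) x) (S n (\<omega> n) y) \<le> L n (\<omega> n) * dist x y"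
      by (intro AE_PiM_component[where P = "\<lambda>\<theta>. \<forall>x y. dist (S n \<theta> x) (S n \<theta> y) \<le> L n \<theta> * dist x y"])
         (auto intro: prob lipschitz)
  qed
  then show ?thesis
  proof (rule AE_mp, intro AE_I2 impI allI)
    fix \<omega> n x y
    assume \<omega>: "\<omega> \<in> space P"
      and lip: "\<forall>n. n \<ge> 1 \<longrightarrow> (\<forall>x y. dist (S n (\<omega> n) x) (S n (\<omega> n) y) \<le> L n (\<omega> n) * dist x y)"
    show "dist (composed S n \<omega> x) (composed S n \<omega> y) \<le> Lip n \<omega> * dist x y"
    proof (induction n)
      case (Suc n)
      have pos: "L (Suc n) (\<omega> (Suc n)) > 0"
        using \<omega> by (intro L_pos) (auto simp: space_PiM PiE_iff)
      have "dist (composed S (Suc n) \<omega> x) (composed S (Suc n) \<omega> y)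
          \<le> L (Suc n) (\<omega> (Suc n)) * dist (composed S n \<omega> x) (composed S n \<omega> y)"
        using lip[rule_format, of "Suc n"] by simp
      also have "\<dots> \<le> L (Suc n) (\<omega> (Suc n)) * (Lip n \<omega> * dist x y)"
        using Suc pos by (intro mult_left_mono) auto
      also have "\<dots> = Lip (Suc n) \<omega> * dist x y" by (simp add: Lip_def)
      finally show ?case .
    qed (simp add: Lip_def)
  qed
qed

lemma AE_Lip_tendsto_0: "AE \<omega> in P. (\<lambda>n. Lip n \<omega>) \<longlonglongrightarrow> 0"
proof -
  \<comment> \<open>The absolute value supplies nonnegativity at every \<open>\<omega>\<close>;
    \<open>Lip\<close> is known to be positive only on \<open>space P\<close>.\<close>
  have "AE \<omega> in P. summable (\<lambda>n. \<bar>Lip n \<omega>\<bar>)"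
  proof (rule AE_summable_of_powr_moments[where t = s and q = q and K = 1])
    fix n
    have "(\<integral>\<^sup>+ \<omega>. ennreal (\<bar>Lip n \<omega>\<bar> powr s) \<partial>P) = (\<integral>\<^sup>+ \<omega>. ennreal (Lip n \<omega> powr s) \<partial>P)"
      using Lip_pos by (intro nn_integral_cong) (simp add: abs_of_pos)
    also have "\<dots> \<le> ennreal (q ^ n * q ^ n)" by (rule Lip_moment)
    also have "\<dots> \<le> ennreal (1 * q ^ n)"
      using q by (intro ennreal_leI mult_right_mono power_le_one) auto
    finally show "(\<integral>\<^sup>+ \<omega>. ennreal (\<bar>Lip n \<omega>\<bar> powr s) \<partial>P) \<le> ennreal (1 * q ^ n)" .
  qed (use s q in auto)
  then show ?thesis
    by eventually_elim (rule summable_LIMSEQ_zero[OF summable_rabs_cancel])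
qed

end

section \<open>The almost sure limit of the forward orbits\<close>

text \<open>\<open>increment\<close> isolates what invertibility and conjugation contribute. It will
  be instantiated with \<open>t = s / 2\<close>, \<open>K = 2 + \<delta>\<close> and
  \<open>N = n\<^sub>0\<close>.\<close>

locale converging_maps = contracting_maps \<Theta> S L s q
  for \<Theta> :: "nat \<Rightarrow> 'b measure" and S :: "nat \<Rightarrow> 'b \<Rightarrow> 'a::polish_space \<Rightarrow> 'a"
    and L :: "nat \<Rightarrow> 'b \<Rightarrow> real" and s q :: real +
  fixes x\<^sub>0 :: 'a and t K :: real and N :: nat
  assumes t: "0 < t" "t \<le> 1" and K: "K \<ge> 0"
    and increment: "\<And>n. n \<ge> N \<Longrightarrow>
      (\<integral>\<^sup>+ \<omega>. ennreal (dist (composed S n \<omega> x\<^sub>0) (composed S (Suc n) \<omega> x\<^sub>0) powr t) \<partial>P) \<le> ennreal (K * q ^ n)"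
begin

lemma orbit_measurable[measurable]: "(\<lambda>\<omega>. composed S n \<omega> x) \<in> P \<rightarrow>\<^sub>M borel"
  by (rule composed_measurable) simp

lemma AE_orbit_convergent: "AE \<omega> in P. convergent (\<lambda>n. composed S n \<omega> x\<^sub>0)"
proof -
  have "AE \<omega> in P. summable (\<lambda>n. dist (composed S (n + N) \<omega> x\<^sub>0) (composed S (Suc (n + N)) \<omega> x\<^sub>0))"
  proof (rule AE_summable_of_powr_moments[where t = t and q = q and K = K])
    fix n
    have "(\<integral>\<^sup>+ \<omega>. ennreal (dist (composed S (n + N) \<omega> x\<^sub>0) (composed S (Suc (n + N)) \<omega> x\<^sub>0) powr t) \<partial>P)
        \<le> ennreal (K * q ^ (n + N))"
      by (rule increment) simp
    also have "\<dots> \<le> ennreal (K * q ^ n)"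
      using q K by (intro ennreal_leI mult_left_mono power_decreasing) auto
    finally show "(\<integral>\<^sup>+ \<omega>. ennreal (dist (composed S (n + N) \<omega> x\<^sub>0) (composed S (Suc (n + N)) \<omega> x\<^sub>0) powr t) \<partial>P)
        \<le> ennreal (K * q ^ n)" .
  qed (use t q K in \<open>auto simp del: composed.simps\<close>)
  then show ?thesis
  proof eventually_elim
    case (elim \<omega>)
    then have "summable (\<lambda>n. dist (composed S n \<omega> x\<^sub>0) (composed S (Suc n) \<omega> x\<^sub>0))"
      by (subst (asm) summable_iff_shift)
    then show ?case by (rule summable_dist_imp_convergent)
  qed
qed

text \<open>Any orbit is within \<open>Lip n \<omega> * dist x x\<^sub>0\<close> of the orbit of
  \<open>x\<^sub>0\<close>, and this tends to 0. The limit is therefore the same for all starting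
  points, with one null set for all of them, which later permits a random start.\<close>

lemma exists_limit:
  "\<exists>Z. Z \<in> P \<rightarrow>\<^sub>M borel \<and> (AE \<omega> in P. \<forall>x. (\<lambda>n. composed S n \<omega> x) \<longlonglongrightarrow> Z \<omega>)"
proof -
  \<comment> \<open>Off the measurable set \<open>G\<close> the orbit is replaced by a constant; the
    modified sequence converges everywhere, so its limit is measurable.\<close>
  define G where "G = {\<omega> \<in> space P. Cauchy (\<lambda>n. composed S n \<omega> x\<^sub>0)}"
  define F where "F n \<omega> = (if \<omega> \<in> G then composed S n \<omega> x\<^sub>0 else x\<^sub>0)" for n \<omega>
  define Z where "Z \<omega> = Topological_Spaces.lim (\<lambda>n. F n \<omega>)" for \<omega>
  have G[measurable]: "G \<in> sets P" unfolding G_def by measurable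
  have [measurable]: "F n \<in> P \<rightarrow>\<^sub>M borel" for n
    unfolding F_def by measurable
  have lim: "(\<lambda>n. F n \<omega>) \<longlonglongrightarrow> Z \<omega>" for \<omega>
    unfolding Z_def convergent_LIMSEQ_iff[symmetric] F_def
    by (cases "\<omega> \<in> G") (auto simp: G_def Cauchy_convergent convergent_const)
  have "Z \<in> P \<rightarrow>\<^sub>M borel"
    by (rule borel_measurable_LIMSEQ_metric[OF _ lim]) measurable
  moreover have "AE \<omega> in P. \<forall>x. (\<lambda>n. composed S n \<omega> x) \<longlonglongrightarrow> Z \<omega>"
    using AE_orbit_convergent AE_composed_lipschitz AE_Lip_tendsto_0 AE_space
  proof eventually_elim
    case (elim \<omega>)
    then have "\<omega> \<in> G" by (simp add: G_def convergent_Cauchy)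
    then have lim0: "(\<lambda>n. composed S n \<omega> x\<^sub>0) \<longlonglongrightarrow> Z \<omega>" using lim[of \<omega>] by (simp add: F_def)
    show ?case
    proof
      fix x
      have le: "dist (composed S n \<omega> x) (Z \<omega>)
          \<le> Lip n \<omega> * dist x x\<^sub>0 + dist (composed S n \<omega> x\<^sub>0) (Z \<omega>)" for n
        using elim(2)[rule_format, of n x x\<^sub>0] dist_triangle[of "composed S n \<omega> x" "Z \<omega>" "composed S n \<omega> x\<^sub>0"]
        by linarith
      have "(\<lambda>n. Lip n \<omega> * dist x x\<^sub>0 + dist (composed S n \<omega> x\<^sub>0) (Z \<omega>)) \<longlonglongrightarrow> 0"
        using tendsto_add[OF tendsto_mult_left_zero[OF elim(3)] tendsto_dist_iff[THEN iffD1, OF lim0]] by simp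
      then have "(\<lambda>n. dist (composed S n \<omega> x) (Z \<omega>)) \<longlonglongrightarrow> 0"
        by (rule tendsto_sandwich[OF always_eventually always_eventually tendsto_const, rotated 2])
           (simp_all add: le)
      then show "(\<lambda>n. composed S n \<omega> x) \<longlonglongrightarrow> Z \<omega>"
        by (rule tendsto_dist_iff[THEN iffD2])
    qed
  qed
  ultimately show ?thesis by blast
qed

end

section \<open>Convergence of the laws to the law of the limit, and its rate\<close>

context converging_maps
begin

context
  fixes Z
  assumes Z_measurable[measurable]: "Z \<in> P \<rightarrow>\<^sub>M borel"
    and Z_limit: "AE \<omega> in P. \<forall>x. (\<lambda>n. composed S n \<omega> x) \<longlonglongrightarrow> Z \<omega>"
begin

text \<open>Since the almost sure limit exists from every starting point at once, it persists when
  the start is drawn from \<open>\<mu>\<close>; dominated convergence on the product does the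
  rest.\<close>

lemma law_weakly_converges:
  assumes \<mu>: "\<mu> \<in> borel_probs"
  shows "weakly_converges (law \<Theta> S \<mu>) (distr P borel Z)"
  unfolding weakly_converges_def
proof (intro allI impI)
  fix f :: "'a \<Rightarrow> real" assume f: "continuous_on UNIV f \<and> bounded (range f)"
  then have [measurable]: "f \<in> borel_measurable borel" by (simp add: borel_measurable_continuous_onI)
  from f obtain b where b: "\<And>x. \<bar>f x\<bar> \<le> b" by (auto simp: bounded_iff)
  interpret mu: prob_space \<mu> using \<mu> by (simp add: borel_probs_def)
  interpret Q: pair_prob_space \<mu> P ..
  have sets_\<mu>: "sets \<mu> = sets borel" using \<mu> by (simp add: borel_probs_def)
  note [measurable] = composed_measurable_pair'[OF sets_\<mu>]
  have AE_snd: "AE z in \<mu> \<Otimes>\<^sub>M P. \<forall>x. (\<lambda>n. composed S n (snd z) x) \<longlonglongrightarrow> Z (snd z)"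
    by (rule Q.AE_pair_snd[OF Z_limit])
  have "(\<lambda>n. \<integral>z. f (composed S n (snd z) (fst z)) \<partial>(\<mu> \<Otimes>\<^sub>M P)) \<longlonglongrightarrow> (\<integral>z. f (Z (snd z)) \<partial>(\<mu> \<Otimes>\<^sub>M P))"
  proof (rule integral_dominated_convergence[where w = "\<lambda>_. b"])
    show "AE z in \<mu> \<Otimes>\<^sub>M P. (\<lambda>n. f (composed S n (snd z) (fst z))) \<longlonglongrightarrow> f (Z (snd z))"
      using AE_snd
    proof eventually_elim
      case (elim z)
      have "isCont f (Z (snd z))" using f by (simp add: continuous_on_eq_continuous_at)
      then show ?case by (rule isCont_tendsto_compose) (use elim in blast)
    qed
  qed (auto simp: b)
  moreover have "(\<integral>x. f x \<partial>law \<Theta> S \<mu> n) = (\<integral>z. f (composed S n (snd z) (fst z)) \<partial>(\<mu> \<Otimes>\<^sub>M P))" for n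
    unfolding law_eq_distr[OF \<mu>] by (rule integral_distr) measurable
  \<comment> \<open>The limit ignores the initial point, so only the second marginal
    matters.\<close>
  moreover have "(\<integral>x. f x \<partial>distr P borel Z) = (\<integral>z. f (Z (snd z)) \<partial>(\<mu> \<Otimes>\<^sub>M P))"
  proof -
    have "(\<integral>x. f x \<partial>distr P borel Z) = (\<integral>\<omega>. f (Z \<omega>) \<partial>distr (\<mu> \<Otimes>\<^sub>M P) P snd)"
      unfolding Q.distr_pair_snd by (rule integral_distr) measurable
    also have "\<dots> = (\<integral>z. f (Z (snd z)) \<partial>(\<mu> \<Otimes>\<^sub>M P))"
      by (rule integral_distr) measurable
    finally show ?thesis .
  qed
  ultimately show "(\<lambda>n. \<integral>x. f x \<partial>law \<Theta> S \<mu> n) \<longlonglongrightarrow> (\<integral>x. f x \<partial>distr P borel Z)" by simp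
qed

text \<open>The means of \<open>f\<close> along the orbit of \<open>x\<^sub>0\<close> have
  geometrically small increments and converge to the mean under the law of \<open>Z\<close>; the
  geometric tail is the bound.\<close>

lemma orbit_integral_bound:
  assumes f: "f \<in> bounded_lipschitz" and n: "n \<ge> N"
  shows "\<bar>(\<integral>\<omega>. f (composed S n \<omega> x\<^sub>0) \<partial>P) - (\<integral>x. f x \<partial>distr P borel Z)\<bar> \<le> 2 * K / (1 - q) * q ^ n"
proof (rule abs_diff_limit_le_geometric[where N = N])
  note [measurable] = bounded_lipschitz_measurable[OF f]
  note b = bounded_lipschitz_abs_le[OF f]
  have int: "integrable P (\<lambda>\<omega>. f (composed S n \<omega> x\<^sub>0))" for n
    using b by (intro P.integrable_const_bound[where B = 1]) auto
  fix n assume n: "n \<ge> N"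
  have "\<bar>\<integral>\<omega>. f (composed S (Suc n) \<omega> x\<^sub>0) - f (composed S n \<omega> x\<^sub>0) \<partial>P\<bar> \<le> 2 * K * q ^ n"
  proof (rule P.abs_integral_le)
    have "(\<integral>\<^sup>+ \<omega>. ennreal \<bar>f (composed S (Suc n) \<omega> x\<^sub>0) - f (composed S n \<omega> x\<^sub>0)\<bar> \<partial>P)
        \<le> (\<integral>\<^sup>+ \<omega>. 2 * ennreal (dist (composed S n \<omega> x\<^sub>0) (composed S (Suc n) \<omega> x\<^sub>0) powr t) \<partial>P)"
    proof (rule nn_integral_mono)
      fix \<omega>
      have "ennreal \<bar>f (composed S (Suc n) \<omega> x\<^sub>0) - f (composed S n \<omega> x\<^sub>0)\<bar>
          \<le> ennreal (2 * dist (composed S n \<omega> x\<^sub>0) (composed S (Suc n) \<omega> x\<^sub>0) powr t)"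
        using bounded_lipschitz_le_powr[OF f t] by (subst abs_minus_commute) (rule ennreal_leI)
      then show "ennreal \<bar>f (composed S (Suc n) \<omega> x\<^sub>0) - f (composed S n \<omega> x\<^sub>0)\<bar>
          \<le> 2 * ennreal (dist (composed S n \<omega> x\<^sub>0) (composed S (Suc n) \<omega> x\<^sub>0) powr t)"
        by (simp add: ennreal_mult del: composed.simps)
    qed
    also have "\<dots> = 2 * (\<integral>\<^sup>+ \<omega>. ennreal (dist (composed S n \<omega> x\<^sub>0) (composed S (Suc n) \<omega> x\<^sub>0) powr t) \<partial>P)"
      by (intro nn_integral_cmult) (simp del: composed.simps)
    also have "\<dots> \<le> 2 * ennreal (K * q ^ n)"
      by (intro mult_left_mono increment n) simp
    also have "\<dots> = ennreal (2 * K * q ^ n)"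
      using K q by (simp add: ennreal_mult mult.assoc)
    finally show "(\<integral>\<^sup>+ \<omega>. ennreal \<bar>f (composed S (Suc n) \<omega> x\<^sub>0) - f (composed S n \<omega> x\<^sub>0)\<bar> \<partial>P)
        \<le> ennreal (2 * K * q ^ n)" .
  qed (use K q in \<open>simp_all del: composed.simps\<close>)
  then show "\<bar>(\<integral>\<omega>. f (composed S (Suc n) \<omega> x\<^sub>0) \<partial>P) - (\<integral>\<omega>. f (composed S n \<omega> x\<^sub>0) \<partial>P)\<bar> \<le> 2 * K * q ^ n"
    using int by (simp del: composed.simps)
next
  note [measurable] = bounded_lipschitz_measurable[OF f]
  note b = bounded_lipschitz_abs_le[OF f]
  have cont: "continuous_on UNIV f"
    using f by (auto simp: bounded_lipschitz_def intro: lipschitz_on_continuous_on)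
  have "(\<lambda>n. \<integral>\<omega>. f (composed S n \<omega> x\<^sub>0) \<partial>P) \<longlonglongrightarrow> (\<integral>\<omega>. f (Z \<omega>) \<partial>P)"
  proof (rule integral_dominated_convergence[where w = "\<lambda>_. 1"])
    show "AE \<omega> in P. (\<lambda>n. f (composed S n \<omega> x\<^sub>0)) \<longlonglongrightarrow> f (Z \<omega>)"
      using Z_limit
    proof eventually_elim
      case (elim \<omega>)
      have "isCont f (Z \<omega>)" using cont by (simp add: continuous_on_eq_continuous_at)
      then show ?case by (rule isCont_tendsto_compose) (use elim in blast)
    qed
  qed (auto simp: b)
  also have "(\<integral>\<omega>. f (Z \<omega>) \<partial>P) = (\<integral>x. f x \<partial>distr P borel Z)"
    by (rule integral_distr[symmetric]) measurable
  finally show "(\<lambda>n. \<integral>\<omega>. f (composed S n \<omega> x\<^sub>0) \<partial>P) \<longlonglongrightarrow> (\<integral>x. f x \<partial>distr P borel Z)" .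
qed (use K q n in auto)

text \<open>Both orbits are driven by the same parameters. The initial distance and
  \<open>Lip n\<close> live on different factors of the product, so their moments multiply.\<close>

lemma law_orbit_integral_bound:
  assumes f: "f \<in> bounded_lipschitz" and \<mu>1: "\<mu> \<in> borel_probs_1"
  shows "\<bar>(\<integral>x. f x \<partial>law \<Theta> S \<mu> n) - (\<integral>\<omega>. f (composed S n \<omega> x\<^sub>0) \<partial>P)\<bar>
    \<le> 2 * q ^ n * (1 + (\<integral>x. dist x x\<^sub>0 \<partial>\<mu>))"
proof -
  have \<mu>: "\<mu> \<in> borel_probs" using \<mu>1 by (simp add: borel_probs_1_def)
  have sets_\<mu>[measurable_cong]: "sets \<mu> = sets borel" using \<mu> by (simp add: borel_probs_def)
  interpret mu: prob_space \<mu> using \<mu> by (simp add: borel_probs_def)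
  interpret Q: pair_prob_space \<mu> P ..
  let ?Q = "\<mu> \<Otimes>\<^sub>M P" and ?I = "\<integral>x. dist x x\<^sub>0 \<partial>\<mu>"
  note [measurable] = bounded_lipschitz_measurable[OF f] composed_measurable_pair'[OF sets_\<mu>]
  note b = bounded_lipschitz_abs_le[OF f]
  have int1: "integrable ?Q (\<lambda>z. f (composed S n (snd z) (fst z)))"
    using b by (intro Q.integrable_const_bound[where B = 1]) auto
  have int2: "integrable ?Q (\<lambda>z. f (composed S n (snd z) x\<^sub>0))"
    using b by (intro Q.integrable_const_bound[where B = 1]) auto
  have law: "(\<integral>x. f x \<partial>law \<Theta> S \<mu> n) = (\<integral>z. f (composed S n (snd z) (fst z)) \<partial>?Q)"
    unfolding law_eq_distr[OF \<mu>] by (rule integral_distr) measurable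
  have orbit: "(\<integral>\<omega>. f (composed S n \<omega> x\<^sub>0) \<partial>P) = (\<integral>z. f (composed S n (snd z) x\<^sub>0) \<partial>?Q)"
  proof -
    have "(\<integral>\<omega>. f (composed S n \<omega> x\<^sub>0) \<partial>P) = (\<integral>\<omega>. f (composed S n \<omega> x\<^sub>0) \<partial>distr ?Q P snd)"
      unfolding Q.distr_pair_snd ..
    also have "\<dots> = (\<integral>z. f (composed S n (snd z) x\<^sub>0) \<partial>?Q)"
      by (rule integral_distr) measurable
    finally show ?thesis .
  qed
  have I: "?I \<ge> 0" by (rule Bochner_Integration.integral_nonneg) simp
  have "\<bar>\<integral>z. f (composed S n (snd z) (fst z)) - f (composed S n (snd z) x\<^sub>0) \<partial>?Q\<bar> \<le> 2 * q ^ n * (1 + ?I)"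
  proof (rule Q.abs_integral_le)
    have AE_snd: "AE z in ?Q. \<forall>n x y. dist (composed S n (snd z) x) (composed S n (snd z) y) \<le> Lip n (snd z) * dist x y"
      by (rule Q.AE_pair_snd[OF AE_composed_lipschitz])
    have "(\<integral>\<^sup>+ z. ennreal \<bar>f (composed S n (snd z) (fst z)) - f (composed S n (snd z) x\<^sub>0)\<bar> \<partial>?Q)
        \<le> (\<integral>\<^sup>+ z. ennreal (2 * dist (fst z) x\<^sub>0 powr s) * ennreal (Lip n (snd z) powr s) \<partial>?Q)"
    proof (rule nn_integral_mono_AE)
      show "AE z in ?Q. ennreal \<bar>f (composed S n (snd z) (fst z)) - f (composed S n (snd z) x\<^sub>0)\<bar>
          \<le> ennreal (2 * dist (fst z) x\<^sub>0 powr s) * ennreal (Lip n (snd z) powr s)"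
        using AE_snd
      proof eventually_elim
        case (elim z)
        have "\<bar>f (composed S n (snd z) (fst z)) - f (composed S n (snd z) x\<^sub>0)\<bar>
            \<le> 2 * dist (composed S n (snd z) (fst z)) (composed S n (snd z) x\<^sub>0) powr s"
          by (rule bounded_lipschitz_le_powr[OF f s])
        also have "\<dots> \<le> 2 * (Lip n (snd z) * dist (fst z) x\<^sub>0) powr s"
          using elim s by (intro mult_left_mono powr_mono2) auto
        also have "\<dots> = 2 * dist (fst z) x\<^sub>0 powr s * Lip n (snd z) powr s"
          by (simp add: powr_mult)
        finally show ?case by (simp add: ennreal_mult[symmetric])
      qed
    qed
    also have "\<dots> = (\<integral>\<^sup>+ x. \<integral>\<^sup>+ \<omega>. ennreal (2 * dist x x\<^sub>0 powr s) * ennreal (Lip n \<omega> powr s) \<partial>P \<partial>\<mu>)"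
      by (subst P.nn_integral_fst[symmetric]) auto
    also have "\<dots> = (\<integral>\<^sup>+ x. ennreal (2 * dist x x\<^sub>0 powr s) * (\<integral>\<^sup>+ \<omega>. ennreal (Lip n \<omega> powr s) \<partial>P) \<partial>\<mu>)"
      by (intro nn_integral_cong nn_integral_cmult) measurable
    \<comment> \<open>The factor \<open>1 + dist x x\<^sub>0\<close> of the final estimate
      originates here, as a bound for the power \<open>s\<close> of the distance; one factor
      \<open>q ^ n\<close> of \<open>Lip_moment\<close> is given up.\<close>
    also have "\<dots> \<le> (\<integral>\<^sup>+ x. ennreal (2 * (1 + dist x x\<^sub>0)) * ennreal (q ^ n) \<partial>\<mu>)"
    proof (intro nn_integral_mono mult_mono ennreal_leI mult_left_mono)
      show "dist x x\<^sub>0 powr s \<le> 1 + dist x x\<^sub>0" for x using s by (intro powr_le_one_plus) auto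
      have "q ^ n * q ^ n \<le> 1 * q ^ n" using q by (intro mult_right_mono power_le_one) auto
      then show "(\<integral>\<^sup>+ \<omega>. ennreal (Lip n \<omega> powr s) \<partial>P) \<le> ennreal (q ^ n)"
        by (intro order.trans[OF Lip_moment] ennreal_leI) simp
    qed auto
    also have "\<dots> = (\<integral>\<^sup>+ x. ennreal (2 * q ^ n * (1 + dist x x\<^sub>0)) \<partial>\<mu>)"
      using q by (intro nn_integral_cong, subst ennreal_mult[symmetric]) (auto simp: mult_ac)
    also have "\<dots> = ennreal (\<integral>x. 2 * q ^ n * (1 + dist x x\<^sub>0) \<partial>\<mu>)"
      using q borel_probs_1_integrable_dist[OF \<mu>1, of x\<^sub>0] by (intro nn_integral_eq_integral) auto
    also have "(\<integral>x. 2 * q ^ n * (1 + dist x x\<^sub>0) \<partial>\<mu>) = 2 * q ^ n * (1 + ?I)"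
      using borel_probs_1_integrable_dist[OF \<mu>1, of x\<^sub>0] by (simp add: mu.prob_space)
    finally show "(\<integral>\<^sup>+ z. ennreal \<bar>f (composed S n (snd z) (fst z)) - f (composed S n (snd z) x\<^sub>0)\<bar> \<partial>?Q)
        \<le> ennreal (2 * q ^ n * (1 + ?I))" .
  qed (use q I in auto)
  then show ?thesis using int1 int2 by (simp add: law orbit)
qed

end

theorem law_converges_geometrically:
  "\<exists>\<pi>\<in>borel_probs. \<exists>C\<ge>0.
    (\<forall>\<mu>\<in>borel_probs_1. \<forall>n. dist_BL (law \<Theta> S \<mu> n) \<pi> \<le> C * q ^ n * (1 + (\<integral>x. dist x x\<^sub>0 \<partial>\<mu>))) \<and>
    (\<forall>\<mu>\<in>borel_probs. weakly_converges (law \<Theta> S \<mu>) \<pi>)"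
proof -
  obtain Z where Z: "Z \<in> P \<rightarrow>\<^sub>M borel" "AE \<omega> in P. \<forall>x. (\<lambda>n. composed S n \<omega> x) \<longlonglongrightarrow> Z \<omega>"
    using exists_limit by blast
  let ?\<pi> = "distr P borel Z"
  have \<pi>: "?\<pi> \<in> borel_probs"
    using Z(1) by (simp add: borel_probs_def P.prob_space_distr)
  \<comment> \<open>The first two summands come from the orbit of \<open>x\<^sub>0\<close> and from
    the comparison of starting points, for \<open>n \<ge> N\<close>. The last one covers
    \<open>n < N\<close>, where the trivial bound 2 is at most
    \<open>2 / q ^ N * q ^ n\<close>.\<close>
  define C where "C = 2 * K / (1 - q) + 2 + 2 / q ^ N"
  have C: "2 * K / (1 - q) + 2 \<le> C" "2 / q ^ N \<le> C" "C \<ge> 0" using q K by (auto simp: C_def)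
  have "dist_BL (law \<Theta> S \<mu> n) ?\<pi> \<le> C * q ^ n * (1 + (\<integral>x. dist x x\<^sub>0 \<partial>\<mu>))" if \<mu>1: "\<mu> \<in> borel_probs_1" for \<mu> n
  proof (rule dist_BL_le)
    fix f :: "'a \<Rightarrow> real" assume f: "f \<in> bounded_lipschitz"
    define I where "I = (\<integral>x. dist x x\<^sub>0 \<partial>\<mu>)"
    have I: "I \<ge> 0" unfolding I_def by (rule Bochner_Integration.integral_nonneg) simp
    have \<mu>: "\<mu> \<in> borel_probs" using \<mu>1 by (simp add: borel_probs_1_def)
    have "\<bar>(\<integral>x. f x \<partial>law \<Theta> S \<mu> n) - (\<integral>x. f x \<partial>?\<pi>)\<bar> \<le> C * q ^ n * (1 + I)"
    proof (cases "n \<ge> N")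
      case True
      have "\<bar>(\<integral>x. f x \<partial>law \<Theta> S \<mu> n) - (\<integral>x. f x \<partial>?\<pi>)\<bar> \<le> 2 * q ^ n * (1 + I) + 2 * K / (1 - q) * q ^ n"
        using orbit_integral_bound[OF Z f True] law_orbit_integral_bound[OF Z f \<mu>1, of n]
        unfolding I_def by linarith
      also have "\<dots> \<le> 2 * q ^ n * (1 + I) + 2 * K / (1 - q) * q ^ n * (1 + I)"
        using mult_left_mono[of 1 "1 + I" "2 * K / (1 - q) * q ^ n"] I K q by simp
      also have "\<dots> = (2 * K / (1 - q) + 2) * (q ^ n * (1 + I))"
        by (simp add: algebra_simps)
      also have "\<dots> \<le> C * (q ^ n * (1 + I))" using C I q by (intro mult_right_mono) auto
      finally show ?thesis by (simp add: mult.assoc)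
    next
      case False
      have "\<bar>(\<integral>x. f x \<partial>law \<Theta> S \<mu> n) - (\<integral>x. f x \<partial>?\<pi>)\<bar> \<le> 2"
        by (intro abs_integral_diff_le_2 law_in_borel_probs prob S_measurable \<mu> \<pi> f)
      also have "2 \<le> 2 / q ^ N * q ^ n"
        using q False power_decreasing[of n N q] by (simp add: field_simps)
      also have "\<dots> \<le> C * q ^ n" using C q by (intro mult_right_mono) auto
      also have "\<dots> = C * q ^ n * 1" by simp
      also have "\<dots> \<le> C * q ^ n * (1 + I)" using C q I by (intro mult_left_mono) auto
      finally show ?thesis .
    qed
    then show "\<bar>(\<integral>x. f x \<partial>law \<Theta> S \<mu> n) - (\<integral>x. f x \<partial>?\<pi>)\<bar> \<le> C * q ^ n * (1 + (\<integral>x. dist x x\<^sub>0 \<partial>\<mu>))"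
      unfolding I_def .
  qed
  with \<pi> C(3) law_weakly_converges[OF Z] show ?thesis by blast
qed

end

section \<open>Moments of the increments through conjugation\<close>

lemma bij_composed:
  assumes "\<And>k. k \<in> {1..n} \<Longrightarrow> bij (S k (\<theta> k))"
  shows "bij (composed S n \<theta>)"
  using assms by (induction n) (auto intro: bij_comp simp del: atLeastAtMost_iff simp: atLeastAtMostSuc_conv)

text \<open>AM-GM with a weight, from the square of \<open>a - c * b\<close>. With
  \<open>c = q ^ m\<close> it balances a square of mean at most \<open>q ^ m * q ^ m\<close> against
  one of bounded mean.\<close>

lemma mult_le_weighted_squares:
  fixes a b c :: real
  assumes "c > 0" "a \<ge> 0" "b \<ge> 0"
  shows "a * b \<le> a\<^sup>2 / c + c * b\<^sup>2"
proof -
  have "0 \<le> (a - c * b)\<^sup>2" by simp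
  then have "2 * (a * b * c) \<le> a\<^sup>2 + c\<^sup>2 * b\<^sup>2" by (simp add: power2_eq_square algebra_simps)
  moreover have "a * b * c \<ge> 0" using assms by simp
  moreover have "(a\<^sup>2 / c + c * b\<^sup>2) * c = a\<^sup>2 + c\<^sup>2 * b\<^sup>2"
    using assms by (simp add: power2_eq_square distrib_right)
  ultimately have "a * b * c \<le> (a\<^sup>2 / c + c * b\<^sup>2) * c" by linarith
  then show ?thesis using assms by (simp only: mult_le_cancel_right_pos)
qed

text \<open>Conjugating the last map by the composition of the previous ones turns the increment of the
  forward orbit into the image of a pair at distance at most \<open>F \<theta>\<close> under the first \<open>m\<close> maps. The
  dependence between \<open>Lip\<close> and \<open>F\<close> is dealt with by AM-GM at exponent \<open>s / 2\<close>.\<close>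

lemma (in contracting_maps) increment_moment:
  fixes F :: "(nat \<Rightarrow> 'b) \<Rightarrow> real"
  assumes F[measurable]: "F \<in> borel_measurable (Pi\<^sub>M {1..Suc m} \<Theta>)"
    and F_nonneg: "\<And>\<theta>. \<theta> \<in> space (Pi\<^sub>M {1..Suc m} \<Theta>) \<Longrightarrow> F \<theta> \<ge> 0"
    and conj: "AE \<theta> in Pi\<^sub>M {1..Suc m} \<Theta>. (\<forall>k\<in>{1..Suc m}. bij (S k (\<theta> k))) \<and>
        dist x ((inv (composed S m \<theta>) \<circ> S (Suc m) (\<theta> (Suc m)) \<circ> composed S m \<theta>) x) \<le> F \<theta>"
    and mean: "(\<integral>\<^sup>+ \<theta>. ennreal (F \<theta>) \<partial>Pi\<^sub>M {1..Suc m} \<Theta>) \<le> ennreal \<delta>" and \<delta>: "\<delta> \<ge> 0"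
  shows "(\<integral>\<^sup>+ \<omega>. ennreal (dist (composed S m \<omega> x) (composed S (Suc m) \<omega> x) powr (s / 2)) \<partial>P)
    \<le> ennreal ((2 + \<delta>) * q ^ m)"
proof -
  let ?r = "\<lambda>\<omega>. restrict \<omega> {1..Suc m}"
  have r: "?r \<in> P \<rightarrow>\<^sub>M Pi\<^sub>M {1..Suc m} \<Theta>" by (rule measurable_restrict_subset) simp
  define G where "G \<omega> = F (?r \<omega>)" for \<omega>
  have [measurable]: "G \<in> borel_measurable P"
    unfolding G_def by (rule measurable_compose[OF r F])
  have q': "q ^ m > 0" using q by simp
  have split: "ennreal (a * b + c * (1 + d)) = ennreal a * ennreal b + ennreal c * (1 + ennreal d)"
    if "a \<ge> 0" "b \<ge> 0" "c \<ge> 0" "d \<ge> 0" for a b c d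
    using that by (simp add: ennreal_plus[symmetric] ennreal_mult[symmetric] ennreal_1[symmetric]
        del: ennreal_plus ennreal_1)
  have "(\<integral>\<^sup>+ \<omega>. ennreal (dist (composed S m \<omega> x) (composed S (Suc m) \<omega> x) powr (s / 2)) \<partial>P)
      \<le> (\<integral>\<^sup>+ \<omega>. ennreal (1 / q ^ m) * ennreal (Lip m \<omega> powr s) + ennreal (q ^ m) * (1 + ennreal (G \<omega>)) \<partial>P)"
  proof (rule nn_integral_mono_AE)
    show "AE \<omega> in P. ennreal (dist (composed S m \<omega> x) (composed S (Suc m) \<omega> x) powr (s / 2))
        \<le> ennreal (1 / q ^ m) * ennreal (Lip m \<omega> powr s) + ennreal (q ^ m) * (1 + ennreal (G \<omega>))"
      using AE_PiM_restrict[OF conj finite_atLeastAtMost] AE_composed_lipschitz AE_space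
    proof eventually_elim
      case (elim \<omega>)
      let ?C = "composed S m \<omega>"
      have C: "composed S m (?r \<omega>) = ?C" by (rule composed_cong) auto
      have "bij (composed S m (?r \<omega>))" using elim(1) by (intro bij_composed) auto
      then have bij: "bij ?C" unfolding C .
      \<comment> \<open>This is the conjugated map applied to \<open>x\<close>. The next point of
        the orbit is thus the image of \<open>y\<close> under the same \<open>m\<close> maps that
        carry \<open>x\<close> to the current point.\<close>
      define y where "y = inv ?C (composed S (Suc m) \<omega> x)"
      have y: "?C y = composed S (Suc m) \<omega> x"
        unfolding y_def using bij by (simp add: bij_is_surj surj_f_inv_f del: composed.simps)
      have xy: "dist x y \<le> G \<omega>" using elim(1) unfolding C by (simp add: y_def G_def)
      have pos: "Lip m \<omega> > 0" "G \<omega> \<ge> 0"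
        using Lip_pos[OF elim(3)] F_nonneg[OF measurable_space[OF r elim(3)]] by (auto simp: G_def)
      have "dist (?C x) (?C y) \<le> Lip m \<omega> * dist x y" using elim(2) by blast
      also have "\<dots> \<le> Lip m \<omega> * G \<omega>" using xy pos by (intro mult_left_mono) auto
      finally have "dist (?C x) (?C y) powr (s / 2) \<le> (Lip m \<omega> * G \<omega>) powr (s / 2)"
        using s by (intro powr_mono2) auto
      also have "\<dots> = Lip m \<omega> powr (s / 2) * G \<omega> powr (s / 2)" by (simp add: powr_mult)
      \<comment> \<open>Squaring restores the exponent \<open>s\<close>, for which
        \<open>Lip_moment\<close> is available; the weight gives both terms means of order
        \<open>q ^ m\<close>.\<close>
      also have "\<dots> \<le> (Lip m \<omega> powr (s / 2))\<^sup>2 / q ^ m + q ^ m * (G \<omega> powr (s / 2))\<^sup>2"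
        by (rule mult_le_weighted_squares) (use q' in auto)
      also have "\<dots> = 1 / q ^ m * Lip m \<omega> powr s + q ^ m * G \<omega> powr s"
        by (simp add: power2_eq_square powr_add[symmetric])
      also have "\<dots> \<le> 1 / q ^ m * Lip m \<omega> powr s + q ^ m * (1 + G \<omega>)"
        using q' s pos by (intro add_left_mono mult_left_mono powr_le_one_plus) auto
      finally have "ennreal (dist (?C x) (?C y) powr (s / 2))
          \<le> ennreal (1 / q ^ m * Lip m \<omega> powr s + q ^ m * (1 + G \<omega>))"
        by (rule ennreal_leI)
      also have "\<dots> = ennreal (1 / q ^ m) * ennreal (Lip m \<omega> powr s) + ennreal (q ^ m) * (1 + ennreal (G \<omega>))"
        using q' pos by (intro split) auto
      finally show ?case unfolding y .
    qed
  qed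
  also have "\<dots> = ennreal (1 / q ^ m) * (\<integral>\<^sup>+ \<omega>. ennreal (Lip m \<omega> powr s) \<partial>P)
      + ennreal (q ^ m) * (1 + (\<integral>\<^sup>+ \<omega>. ennreal (G \<omega>) \<partial>P))"
    by (simp add: nn_integral_add nn_integral_cmult P.emeasure_space_1)
  also have "(\<integral>\<^sup>+ \<omega>. ennreal (G \<omega>) \<partial>P) = (\<integral>\<^sup>+ \<theta>. ennreal (F \<theta>) \<partial>Pi\<^sub>M {1..Suc m} \<Theta>)"
    by (rule nn_integral_PiM_restrict[symmetric], rule measurable_compose[OF F measurable_ennreal])
       (auto simp: G_def)
  also have "ennreal (1 / q ^ m) * (\<integral>\<^sup>+ \<omega>. ennreal (Lip m \<omega> powr s) \<partial>P)
      + ennreal (q ^ m) * (1 + (\<integral>\<^sup>+ \<theta>. ennreal (F \<theta>) \<partial>Pi\<^sub>M {1..Suc m} \<Theta>))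
      \<le> ennreal (1 / q ^ m) * ennreal (q ^ m * q ^ m) + ennreal (q ^ m) * (1 + ennreal \<delta>)"
    by (intro add_mono mult_left_mono Lip_moment mean) auto
  also have "\<dots> = ennreal (1 / q ^ m * (q ^ m * q ^ m) + q ^ m * (1 + \<delta>))"
    using q' \<delta> by (intro split[symmetric]) auto
  also have "1 / q ^ m * (q ^ m * q ^ m) + q ^ m * (1 + \<delta>) = (2 + \<delta>) * q ^ m"
    using q' by (simp add: algebra_simps)
  finally show ?thesis .
qed

section \<open>Derivation from the hypotheses of the theorem\<close>

text \<open>Both variables are positive, so intersecting a Borel set with \<open>{0<..}\<close>
  leaves the preimages unchanged; agreement on Borel sets of positive reals is therefore equality of
  laws.\<close>

lemma nn_integral_eq_of_law_eq:
  assumes X: "X \<in> borel_measurable M" "\<And>\<omega>. \<omega> \<in> space M \<Longrightarrow> X \<omega> > 0"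
    and Y: "Y \<in> borel_measurable N" "\<And>\<omega>. \<omega> \<in> space N \<Longrightarrow> Y \<omega> > 0"
    and law: "\<And>E. E \<in> sets borel \<Longrightarrow> E \<subseteq> {0<..} \<Longrightarrow>
      emeasure M (X -` E \<inter> space M) = emeasure N (Y -` E \<inter> space N)"
    and f: "f \<in> borel_measurable (borel :: real measure)"
  shows "(\<integral>\<^sup>+ \<omega>. f (X \<omega>) \<partial>M) = (\<integral>\<^sup>+ \<omega>. f (Y \<omega>) \<partial>N)"
proof -
  have "distr M borel X = distr N borel Y"
  proof (rule measure_eqI)
    fix E assume "E \<in> sets (distr M borel X)"
    then have E: "E \<in> sets borel" by simp
    have "X -` E \<inter> space M = X -` (E \<inter> {0<..}) \<inter> space M" "Y -` E \<inter> space N = Y -` (E \<inter> {0<..}) \<inter> space N"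
      using X(2) Y(2) by auto
    then show "emeasure (distr M borel X) E = emeasure (distr N borel Y) E"
      using X(1) Y(1) E law[of "E \<inter> {0<..}"] by (simp add: emeasure_distr)
  qed simp
  then show ?thesis
    using nn_integral_distr[OF X(1), of f] nn_integral_distr[OF Y(1), of f] f by simp
qed

theorem theorem2p1:
  fixes \<Theta> :: "nat \<Rightarrow> 'b measure"
    and S :: "nat \<Rightarrow> 'b \<Rightarrow> 'a::polish_space \<Rightarrow> 'a"
    and L :: "nat \<Rightarrow> 'b \<Rightarrow> real"
    and M :: "nat \<Rightarrow> (nat \<Rightarrow> 'b) \<Rightarrow> real"
    and n\<^sub>0 :: nat and x\<^sub>0 :: 'a
  assumes prob: "\<And>n. n \<ge> 1 \<Longrightarrow> prob_space (\<Theta> n)"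
    and S_measurable: "\<And>n. n \<ge> 1 \<Longrightarrow> (\<lambda>(x, \<theta>). S n \<theta> x) \<in> borel \<Otimes>\<^sub>M \<Theta> n \<rightarrow>\<^sub>M borel"
    and L_measurable: "\<And>n. n \<ge> 1 \<Longrightarrow> L n \<in> borel_measurable (\<Theta> n)"
    and L_pos: "\<And>n \<theta>. n \<ge> 1 \<Longrightarrow> \<theta> \<in> space (\<Theta> n) \<Longrightarrow> L n \<theta> > 0"
    and n\<^sub>0: "n\<^sub>0 \<ge> 1"
    and M_measurable: "\<And>n. n \<ge> n\<^sub>0 \<Longrightarrow> M n \<in> borel_measurable (Pi\<^sub>M {1..n} \<Theta>)"
    and M_nonneg: "\<And>n \<theta>. n \<ge> n\<^sub>0 \<Longrightarrow> \<theta> \<in> space (Pi\<^sub>M {1..n} \<Theta>) \<Longrightarrow> M n \<theta> \<ge> 0"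
    and A1: "\<And>n. n \<ge> 1 \<Longrightarrow>
      AE \<theta> in \<Theta> n. \<forall>x y. dist (S n \<theta> x) (S n \<theta> y) \<le> L n \<theta> * dist x y"
    and A2_law: "\<And>m n E. m \<ge> 1 \<Longrightarrow> n \<ge> 1 \<Longrightarrow> E \<in> sets borel \<Longrightarrow> E \<subseteq> {0<..} \<Longrightarrow>
      emeasure (\<Theta> m) (L m -` E \<inter> space (\<Theta> m)) = emeasure (\<Theta> n) (L n -` E \<inter> space (\<Theta> n))"
    and A2_mean: "(\<integral>\<^sup>+ \<theta>. ennreal (L 1 \<theta>) \<partial>\<Theta> 1) < \<infinity>"
    and A2_log: "ext_integral (\<Theta> 1) (\<lambda>\<theta>. ln (L 1 \<theta>)) < 0"
    and A3: "\<And>n. n \<ge> n\<^sub>0 \<Longrightarrow>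
      AE \<theta> in Pi\<^sub>M {1..n} \<Theta>. (\<forall>k\<in>{1..n}. bij (S k (\<theta> k))) \<and>
        dist x\<^sub>0 ((inv (composed S (n - 1) \<theta>) \<circ> S n (\<theta> n) \<circ> composed S (n - 1) \<theta>) x\<^sub>0) \<le> M n \<theta>"
    and A4: "(SUP n\<in>{n\<^sub>0..}. iterated_nn_integral \<Theta> n (\<lambda>\<theta>. ennreal (M n \<theta>))) < \<infinity>"
  shows "\<exists>\<pi>\<in>borel_probs. \<exists>q\<in>{0<..<1::real}. \<exists>C\<in>{0::real..}.
    (\<forall>\<mu>\<in>borel_probs_1. \<forall>n\<ge>1.
        dist_BL (law \<Theta> S \<mu> n) \<pi> \<le> C * q ^ n * (1 + (\<integral>x. dist x x\<^sub>0 \<partial>\<mu>))) \<and>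
    (\<forall>\<mu>\<in>borel_probs. weakly_converges (law \<Theta> S \<mu>) \<pi>)"
proof -
  \<comment> \<open>\<open>\<Theta> 0\<close> is arbitrary, but an infinite product needs probability spaces at all indices.\<close>
  define \<Theta>' where "\<Theta>' n = (if n = 0 then \<Theta> 1 else \<Theta> n)" for n
  have \<Theta>': "\<Theta>' n = \<Theta> n" if "n \<ge> 1" for n using that by (simp add: \<Theta>'_def)
  have PiM_\<Theta>': "Pi\<^sub>M {1..n} \<Theta>' = Pi\<^sub>M {1..n} \<Theta>" for n by (intro PiM_cong) (auto simp: \<Theta>'_def)
  have law_eq: "law \<Theta>' S \<mu> n = law \<Theta> S \<mu> n" for \<mu> n by (induction n) (auto simp: \<Theta>')

  obtain \<delta> where \<delta>: "(SUP n\<in>{n\<^sub>0..}. iterated_nn_integral \<Theta> n (\<lambda>\<theta>. ennreal (M n \<theta>))) = ennreal \<delta>" "\<delta> \<ge> 0"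
    using A4 by (cases "SUP n\<in>{n\<^sub>0..}. iterated_nn_integral \<Theta> n (\<lambda>\<theta>. ennreal (M n \<theta>))") auto
  have M_mean: "(\<integral>\<^sup>+ \<theta>. ennreal (M n \<theta>) \<partial>Pi\<^sub>M {1..n} \<Theta>) \<le> ennreal \<delta>" if n: "n \<ge> n\<^sub>0" for n
  proof -
    have "(\<lambda>\<theta>. ennreal (M n \<theta>)) \<in> borel_measurable (Pi\<^sub>M {1..n} \<Theta>)"
      using M_measurable[OF n] by measurable
    from iterated_nn_integral_eq_PiM[OF prob this]
    have "(\<integral>\<^sup>+ \<theta>. ennreal (M n \<theta>) \<partial>Pi\<^sub>M {1..n} \<Theta>) = iterated_nn_integral \<Theta> n (\<lambda>\<theta>. ennreal (M n \<theta>))"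
      by simp
    also have "\<dots> \<le> ennreal \<delta>" unfolding \<delta>(1)[symmetric] using n by (intro SUP_upper) simp
    finally show ?thesis .
  qed

  interpret T1: prob_space "\<Theta> 1" by (rule prob) simp
  obtain s where s: "0 < s" "s \<le> 1" and less1: "(\<integral>\<^sup>+ \<theta>. ennreal (L 1 \<theta> powr s) \<partial>\<Theta> 1) < 1"
    using T1.exists_powr_moment_less_one[OF L_measurable L_pos A2_mean A2_log] by auto
  then obtain r where r: "(\<integral>\<^sup>+ \<theta>. ennreal (L 1 \<theta> powr s) \<partial>\<Theta> 1) = ennreal r" "0 \<le> r" "r < 1"
    by (cases "\<integral>\<^sup>+ \<theta>. ennreal (L 1 \<theta> powr s) \<partial>\<Theta> 1") auto
  \<comment> \<open>The root provides the required bound \<open>q\<^sup>2\<close>; the maximum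
    secures \<open>q > 0\<close> without an argument that \<open>r\<close> is positive.\<close>
  define q where "q = sqrt (max r (1 / 2))"
  have q: "0 < q" "q < 1" "q\<^sup>2 = max r (1 / 2)" using r by (auto simp: q_def)
  have moment: "(\<integral>\<^sup>+ \<theta>. ennreal (L n \<theta> powr s) \<partial>\<Theta> n) \<le> ennreal (q\<^sup>2)" if n: "n \<ge> 1" for n
  proof -
    have "(\<integral>\<^sup>+ \<theta>. ennreal (L n \<theta> powr s) \<partial>\<Theta> n) = (\<integral>\<^sup>+ \<theta>. ennreal (L 1 \<theta> powr s) \<partial>\<Theta> 1)"
      using n by (intro nn_integral_eq_of_law_eq[where f = "\<lambda>x. ennreal (x powr s)"] L_measurable L_pos A2_law) auto
    also have "\<dots> \<le> ennreal (q\<^sup>2)" unfolding r q by (rule ennreal_leI) simp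
    finally show ?thesis .
  qed
  interpret contracting_maps \<Theta>' S L s q
  proof (intro contracting_maps.intro random_maps.intro contracting_maps_axioms.intro)
    show "prob_space (\<Theta>' n)" for n by (simp add: \<Theta>'_def prob)
  qed (use S_measurable L_measurable L_pos A1 s q(1,2) moment \<Theta>' in \<open>simp_all only:\<close>)
  interpret converging_maps \<Theta>' S L s q x\<^sub>0 "s / 2" "2 + \<delta>" n\<^sub>0
  proof unfold_locales
    fix n assume n: "n \<ge> n\<^sub>0"
    \<comment> \<open>The increment from \<open>n\<close> to \<open>Suc n\<close> uses the
      conjugation hypothesis for tuples of length \<open>Suc n\<close>.\<close>
    then have n': "n\<^sub>0 \<le> Suc n" by simp
    show "(\<integral>\<^sup>+ \<omega>. ennreal (dist (composed S n \<omega> x\<^sub>0) (composed S (Suc n) \<omega> x\<^sub>0) powr (s / 2)) \<partial>Pi\<^sub>M UNIV \<Theta>')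
        \<le> ennreal ((2 + \<delta>) * q ^ n)"
      using M_measurable[OF n'] M_nonneg[OF n'] A3[OF n'] M_mean[OF n'] \<delta>(2)
      by (intro increment_moment[where F = "M (Suc n)"]) (simp_all only: PiM_\<Theta>' diff_Suc_1)
  qed (use s \<delta> in auto)
  obtain \<pi> C where "\<pi> \<in> borel_probs" "C \<ge> 0"
    "\<forall>\<mu>\<in>borel_probs_1. \<forall>n. dist_BL (law \<Theta>' S \<mu> n) \<pi> \<le> C * q ^ n * (1 + (\<integral>x. dist x x\<^sub>0 \<partial>\<mu>))"
    "\<forall>\<mu>\<in>borel_probs. weakly_converges (law \<Theta>' S \<mu>) \<pi>"
    using law_converges_geometrically by blast
  moreover have "law \<Theta>' S \<mu> = law \<Theta> S \<mu>" for \<mu> using law_eq by blast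
  ultimately show ?thesis using q
    by (intro bexI[of _ \<pi>] bexI[of _ q] bexI[of _ C]) auto
qed

end
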